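(* Let $X>0$ be a random variable with moments of Gamma type, with associated meromorphic function $F$, let $Y=\log X$, and let $\gamma$, $\rho_-$, $\nu_F$, $c_\ell(\cdot)$ be as in the context. Suppose that $\rho_->-\infty$ and $\gamma>0$. (i) As $x\searrow0$, for some $\eta>0$, $$f_X(x)=x^{|\rho_-|-1}\sum_{\ell=0}^{\nu_F(\rho_-)-1}\frac{c_{\ell+1}(\rho_-)}{\ell!}\log^\ell(1/x)+O\bigl(x^{|\rho_-|-1+\eta}\bigr).$$ In particular, with $\nu:=\nu_F(\rho_-)\ge1$, $$f_X(x)\sim\frac{c_\nu(\rho_-)}{(\nu-1)!}\,x^{|\rho_-|-1}\log^{\nu-1}(1/x).$$ If $\rho_-$ is a simple pole of $F$, i.e. $\nu=1$, this can be written $f_X(x)\sim\operatorname{Res}_{\rho_-}(F)\,x^{|\rho_-|-1}$. (ii) More precisely, there is an asymptotic expansion: for any fixed $\sigma>0$, as $x\searrow0$, $$f_X(x)=\sum_{0>\rho\ge-\sigma}\ \sum_{\ell=0}^{\nu_F(\rho)-1}\frac{c_{\ell+1}(\rho)}{\ell!}\,x^{|\rho|-1}\log^\ell(1/x)+O\bigl(x^{\sigma-1}\bigr),$$ summing over all poles $\rho$ of $F$ in $[-\sigma,0)$. Corresponding asymptotics, as $y\to-\infty$, for $f_Y(y)=e^yf_X(e^y)$ are obtained by replacing each $x^{r-1}$ by $e^{ry}$ and $\log^\ell(1/x)$ by $(-y)^\ell$.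
   Context: A positive random variable $X$ has moments of Gamma type if there exist integers $J,K\ge0$ and real constants $C$, $D>0$, $a_j\ne0$, $b_j$ ($1\le j\le J$), $a'_k\neq0$, $b'_k$ ($1\le k\le K$) such that $$\mathbb E\,X^s=F(s):=C D^s\,\frac{\prod_{j=1}^J\Gamma(a_js+b_j)}{\prod_{k=1}^K\Gamma(a'_ks+b'_k)}$$ for all real $s$ in some interval of positive length. $F$ is regarded as a meromorphic function on $\mathbb C$ (removable singularities removed); all its poles are real. Let $\gamma=\sum_{j}|a_j|-\sum_{k}|a'_k|$ and $\rho_-:=\max\{x<0:x\text{ is a pole of }F\}$, with $\rho_-=-\infty$ if there is no such pole. For a pole $s_0$ of $F$, $\nu_F(s_0)\ge1$ denotes its order, and $c_\ell(s_0)$ are the coefficients of the singular part of the Laurent expansion: $F(s)=\sum_{\ell=1}^{\nu_F(s_0)}c_\ell(s_0)(s-s_0)^{-\ell}+O(1)$ as $s\to s_0$; in particular $c_1(s_0)=\operatorname{Res}_{s_0}(F)$. When $\gamma>0$, $X$ and $Y$ are absolutely continuous with densities continuous on $(0,\infty)$ and $\mathbb R$, respectively; $f_X$ and $f_Y$ denote these. *)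

theory Defs
  imports
    "HOL-Probability.Probability"
    "HOL-Complex_Analysis.Complex_Analysis"
    "HOL-Library.Landau_Symbols"
begin

text \<open>
  The library convention is \<open>Gamma z = 0\<close> at the poles \<open>z = 0, -1, -2, \<dots>\<close>. The raw quotient can thus
  take spurious values at isolated points; \<^const>\<open>remove_sings\<close> replaces its value at every point by
  the limit there, if that exists, and by \<open>0\<close> at the poles.
\<close>

definition gamma_type_fun ::
  "nat \<Rightarrow> nat \<Rightarrow> real \<Rightarrow> real \<Rightarrow> (nat \<Rightarrow> real) \<Rightarrow> (nat \<Rightarrow> real) \<Rightarrow> (nat \<Rightarrow> real) \<Rightarrow> (nat \<Rightarrow> real)
     \<Rightarrow> complex \<Rightarrow> complex" where
  "gamma_type_fun J K C D a b a' b' =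
     remove_sings (\<lambda>s. of_real C * of_real D powr s *
       (\<Prod>j=1..J. Gamma (of_real (a j) * s + of_real (b j))) /
       (\<Prod>k=1..K. Gamma (of_real (a' k) * s + of_real (b' k))))"

text \<open>
  Integrability makes the expectation a genuine (finite) one. Since \<open>X > 0\<close> gives a nonzero
  expectation, whereas the function above is \<open>0\<close> at its poles, the interval contains no pole.
\<close>

definition moments_of_gamma_type ::
  "'a measure \<Rightarrow> ('a \<Rightarrow> real) \<Rightarrow> nat \<Rightarrow> nat \<Rightarrow> real \<Rightarrow> real \<Rightarrow>
     (nat \<Rightarrow> real) \<Rightarrow> (nat \<Rightarrow> real) \<Rightarrow> (nat \<Rightarrow> real) \<Rightarrow> (nat \<Rightarrow> real) \<Rightarrow> bool" where
  "moments_of_gamma_type M X J K C D a b a' b' \<longleftrightarrow>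
     D > 0 \<and> (\<forall>j\<in>{1..J}. a j \<noteq> 0) \<and> (\<forall>k\<in>{1..K}. a' k \<noteq> 0) \<and>
     (\<exists>I::real set. is_interval I \<and> (\<exists>s\<in>I. \<exists>t\<in>I. s < t) \<and>
        (\<forall>s\<in>I. integrable M (\<lambda>\<omega>. X \<omega> powr s) \<and>
           complex_of_real (\<integral>\<omega>. X \<omega> powr s \<partial>M) = gamma_type_fun J K C D a b a' b' (of_real s)))"

definition gamma_exponent :: "nat \<Rightarrow> nat \<Rightarrow> (nat \<Rightarrow> real) \<Rightarrow> (nat \<Rightarrow> real) \<Rightarrow> real" where
  "gamma_exponent J K a a' = (\<Sum>j=1..J. \<bar>a j\<bar>) - (\<Sum>k=1..K. \<bar>a' k\<bar>)"

text \<open>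
  \<open>GREATEST\<close> rather than \<^const>\<open>Max\<close>, as there may be infinitely many negative poles.
\<close>

definition rho_minus :: "(complex \<Rightarrow> complex) \<Rightarrow> ereal" where
  "rho_minus F =
     (if \<exists>x::real. x < 0 \<and> is_pole F (of_real x)
      then ereal (GREATEST x. x < 0 \<and> is_pole F (of_real x)) else -\<infinity>)"

text \<open>\<^const>\<open>zorder\<close> is negative at a pole.\<close>

definition pole_order :: "(complex \<Rightarrow> complex) \<Rightarrow> complex \<Rightarrow> nat" where
  "pole_order F s = nat (- zorder F s)"

definition singular_coeff :: "(complex \<Rightarrow> complex) \<Rightarrow> complex \<Rightarrow> nat \<Rightarrow> complex" where
  "singular_coeff F s l = fls_nth (laurent_expansion F s) (- int l)"

text \<open>
  Nonnegativity is required separately because \<^const>\<open>ennreal\<close> sends negative numbers to \<open>0\<close>. With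
  it, the values on an open set \<open>S\<close> are uniquely determined by \<open>M\<close> and \<open>Z\<close>.
\<close>

definition density_continuous_on ::
  "'a measure \<Rightarrow> ('a \<Rightarrow> real) \<Rightarrow> real set \<Rightarrow> (real \<Rightarrow> real) \<Rightarrow> bool" where
  "density_continuous_on M Z S f \<longleftrightarrow>
     distributed M lborel Z (\<lambda>x. ennreal (f x)) \<and> (\<forall>x. 0 \<le> f x) \<and> continuous_on S f"

end

theory Submission
  imports Defs "HOL-Real_Asymp.Real_Asymp"
begin

text \<open>
  The moment function \<open>\<Phi>(s) = E X\<^sup>s\<close> is holomorphic and bounded in a strip whose closure contains \<open>0\<close> and the given
  interval, and it agrees with \<open>F\<close> there; hence \<open>F\<close> has no poles on the real trace of the closed strip. On vertical
  lines \<open>|F|\<close> decays like \<open>exp(-\<pi>\<gamma>|t|/2)\<close> up to factors \<open>exp(\<epsilon>|t|)\<close>. For this no Stirling formula is needed: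
  Gauss's product shows that \<open>|\<Gamma>(x + iu)| / \<Gamma>(x)\<close> increases in \<open>x\<close>, which reduces everything to the exact value
  \<open>|\<Gamma>(1 + iu)|\<^sup>2 = \<pi>u / sinh(\<pi>u)\<close>. Fourier inversion of the tilted law \<open>exp(cY) dP\<close> then gives the density
  \<open>f_Y(y) = 1/(2\<pi>) \<integral> F(c + it) exp(-(c + it)y) dt\<close>, and moving the line of integration to the left of
  \<open>Re s = -\<sigma>\<close> collects the residues of \<open>F(s) exp(-sy)\<close>, which are the terms of the expansion.
\<close>

section \<open>Growth of the Gamma function on vertical lines\<close>

text \<open>The \<open>\<epsilon>\<close> in \<open>vertical_growth\<close> absorbs polynomial
  factors: exponents simply add under products, and the recurrences of Gamma change nothing. This
  precision suffices, since for \<gamma> > 0 any \<open>\<epsilon>\<close> below the decay rate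
  still leaves absolutely integrable vertical lines and vanishing horizontal edges. The cut-off
  \<open>\<delta>\<close> keeps away from the real axis, which carries all singularities. The given
  moment interval may lie far from 0 on either side, whereas the expansion sums over poles in
  [-\<sigma>, 0). The two fit together because the moment of order 0 is always finite, so no pole
  lies between 0 and the line of integration, 0 itself included. The new line lies strictly left of
  -\<sigma>, so the remainder is slightly better than the claimed order. With \<sigma> the modulus
  of the largest negative pole, this gain is the \<open>\<eta>\<close> of part (i). All asymptotics
  are proved for the density of \<open>Y\<close>; those for \<open>X\<close> follow by substituting
  \<open>y = ln x\<close> and dividing by \<open>x\<close>.\<close>

definition vertical_growth :: "real \<Rightarrow> real \<Rightarrow> (complex \<Rightarrow> complex) \<Rightarrow> real \<Rightarrow> bool" where
  "vertical_growth x1 x2 f \<theta> \<longleftrightarrow> (\<forall>\<delta>>0. \<forall>\<epsilon>>0. \<exists>K\<ge>0. \<forall>s. x1 \<le> Re s \<and> Re s \<le> x2 \<and> \<delta> \<le> \<bar>Im s\<bar> \<longrightarrow>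
     norm (f s) \<le> K * exp ((\<theta> + \<epsilon>) * \<bar>Im s\<bar>))"

lemma vertical_growthI:
  assumes "\<And>\<delta> \<epsilon>. \<delta> > 0 \<Longrightarrow> \<epsilon> > 0 \<Longrightarrow> \<exists>K\<ge>0. \<forall>s. x1 \<le> Re s \<and> Re s \<le> x2 \<and> \<delta> \<le> \<bar>Im s\<bar> \<longrightarrow>
     norm (f s) \<le> K * exp ((\<theta> + \<epsilon>) * \<bar>Im s\<bar>)"
  shows "vertical_growth x1 x2 f \<theta>"
  using assms unfolding vertical_growth_def by blast

lemma vertical_growthE:
  assumes "vertical_growth x1 x2 f \<theta>" "\<delta> > 0" "\<epsilon> > 0"
  obtains K where "K \<ge> 0" "\<And>s. x1 \<le> Re s \<Longrightarrow> Re s \<le> x2 \<Longrightarrow> \<delta> \<le> \<bar>Im s\<bar> \<Longrightarrow>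
     norm (f s) \<le> K * exp ((\<theta> + \<epsilon>) * \<bar>Im s\<bar>)"
  using assms unfolding vertical_growth_def by meson

section \<open>Calculus of growth exponents on vertical strips\<close>

lemma vertical_growth_mult:
  assumes "vertical_growth x1 x2 f \<theta>" "vertical_growth x1 x2 g \<theta>'"
  shows "vertical_growth x1 x2 (\<lambda>s. f s * g s) (\<theta> + \<theta>')"
proof (rule vertical_growthI)
  fix \<delta> \<epsilon> :: real assume pos: "\<delta> > 0" "\<epsilon> > 0"
  obtain K where K: "K \<ge> 0" "\<And>s. x1 \<le> Re s \<Longrightarrow> Re s \<le> x2 \<Longrightarrow> \<delta> \<le> \<bar>Im s\<bar> \<Longrightarrow>
     norm (f s) \<le> K * exp ((\<theta> + \<epsilon>/2) * \<bar>Im s\<bar>)"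
    using vertical_growthE[OF assms(1), of \<delta> "\<epsilon>/2"] pos by auto
  obtain L where L: "L \<ge> 0" "\<And>s. x1 \<le> Re s \<Longrightarrow> Re s \<le> x2 \<Longrightarrow> \<delta> \<le> \<bar>Im s\<bar> \<Longrightarrow>
     norm (g s) \<le> L * exp ((\<theta>' + \<epsilon>/2) * \<bar>Im s\<bar>)"
    using vertical_growthE[OF assms(2), of \<delta> "\<epsilon>/2"] pos by auto
  show "\<exists>K\<ge>0. \<forall>s. x1 \<le> Re s \<and> Re s \<le> x2 \<and> \<delta> \<le> \<bar>Im s\<bar> \<longrightarrow>
     norm (f s * g s) \<le> K * exp ((\<theta> + \<theta>' + \<epsilon>) * \<bar>Im s\<bar>)"
  proof (intro exI[of _ "K * L"] conjI allI impI)
    show "K * L \<ge> 0" using K L by simp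
    fix s assume s: "x1 \<le> Re s \<and> Re s \<le> x2 \<and> \<delta> \<le> \<bar>Im s\<bar>"
    have "norm (f s * g s) \<le> (K * exp ((\<theta> + \<epsilon>/2) * \<bar>Im s\<bar>)) * (L * exp ((\<theta>' + \<epsilon>/2) * \<bar>Im s\<bar>))"
      unfolding norm_mult using s by (intro mult_mono K L) (auto simp: K(1))
    also have "\<dots> = K * L * exp ((\<theta> + \<theta>' + \<epsilon>) * \<bar>Im s\<bar>)"
      by (simp add: algebra_simps flip: exp_add)
    finally show "norm (f s * g s) \<le> K * L * exp ((\<theta> + \<theta>' + \<epsilon>) * \<bar>Im s\<bar>)" .
  qed
qed

lemma vertical_growth_bounded:
  assumes "\<And>\<delta>. \<delta> > 0 \<Longrightarrow> \<exists>K. \<forall>s. x1 \<le> Re s \<and> Re s \<le> x2 \<and> \<delta> \<le> \<bar>Im s\<bar> \<longrightarrow> norm (f s) \<le> K"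
  shows "vertical_growth x1 x2 f 0"
proof (rule vertical_growthI)
  fix \<delta> \<epsilon> :: real assume pos: "\<delta> > 0" "\<epsilon> > 0"
  obtain K where K: "\<And>s. x1 \<le> Re s \<and> Re s \<le> x2 \<and> \<delta> \<le> \<bar>Im s\<bar> \<Longrightarrow> norm (f s) \<le> K"
    using assms[OF pos(1)] by blast
  show "\<exists>K\<ge>0. \<forall>s. x1 \<le> Re s \<and> Re s \<le> x2 \<and> \<delta> \<le> \<bar>Im s\<bar> \<longrightarrow>
     norm (f s) \<le> K * exp ((0 + \<epsilon>) * \<bar>Im s\<bar>)"
  proof (intro exI[of _ "\<bar>K\<bar>"] conjI allI impI)
    fix s assume s: "x1 \<le> Re s \<and> Re s \<le> x2 \<and> \<delta> \<le> \<bar>Im s\<bar>"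
    have "norm (f s) \<le> \<bar>K\<bar> * 1" using K[OF s] by simp
    also have "\<dots> \<le> \<bar>K\<bar> * exp ((0 + \<epsilon>) * \<bar>Im s\<bar>)"
      using pos by (intro mult_left_mono) auto
    finally show "norm (f s) \<le> \<bar>K\<bar> * exp ((0 + \<epsilon>) * \<bar>Im s\<bar>)" .
  qed auto
qed

lemma vertical_growth_const: "vertical_growth x1 x2 (\<lambda>_. c) 0"
  by (rule vertical_growth_bounded) auto

lemma vertical_growth_prod:
  assumes "finite A" "\<And>i. i \<in> A \<Longrightarrow> vertical_growth x1 x2 (f i) (\<theta> i)"
  shows "vertical_growth x1 x2 (\<lambda>s. \<Prod>i\<in>A. f i s) (\<Sum>i\<in>A. \<theta> i)"
  using assms by (induction A rule: finite_induct) (auto intro: vertical_growth_const vertical_growth_mult)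

lemma vertical_growth_powr:
  assumes "D > 0"
  shows "vertical_growth x1 x2 (\<lambda>s. of_real D powr s) 0"
proof (rule vertical_growth_bounded, intro exI allI impI)
  fix \<delta> :: real and s :: complex assume "\<delta> > 0" and s: "x1 \<le> Re s \<and> Re s \<le> x2 \<and> \<delta> \<le> \<bar>Im s\<bar>"
  have "\<bar>Re s * ln D\<bar> \<le> max \<bar>x1\<bar> \<bar>x2\<bar> * \<bar>ln D\<bar>"
    unfolding abs_mult using s by (intro mult_right_mono) auto
  then show "norm (complex_of_real D powr s) \<le> exp (max \<bar>x1\<bar> \<bar>x2\<bar> * \<bar>ln D\<bar>)"
    using assms by (simp add: norm_powr_real_powr powr_def)
qed

text \<open>On a strip only \<open>Im s\<close> is unbounded, and
  \<open>\<epsilon> * t \<le> exp (\<epsilon> * t)\<close> hides it in the slack. Together with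
  \<open>vertical_growth_inverse_ident\<close> this makes the recurrence of Gamma free of
  charge.\<close>

lemma vertical_growth_ident: "vertical_growth x1 x2 (\<lambda>s. s) 0"
proof (rule vertical_growthI)
  fix \<delta> \<epsilon> :: real assume pos: "\<delta> > 0" "\<epsilon> > 0"
  show "\<exists>K\<ge>0. \<forall>s. x1 \<le> Re s \<and> Re s \<le> x2 \<and> \<delta> \<le> \<bar>Im s\<bar> \<longrightarrow>
     norm s \<le> K * exp ((0 + \<epsilon>) * \<bar>Im s\<bar>)"
  proof (intro exI[of _ "max \<bar>x1\<bar> \<bar>x2\<bar> + 1/\<epsilon>"] conjI allI impI)
    fix s assume s: "x1 \<le> Re s \<and> Re s \<le> x2 \<and> \<delta> \<le> \<bar>Im s\<bar>"
    have e: "1 + \<epsilon> * \<bar>Im s\<bar> \<le> exp (\<epsilon> * \<bar>Im s\<bar>)" by (rule exp_ge_add_one_self)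
    have e1: "1 \<le> exp (\<epsilon> * \<bar>Im s\<bar>)" using pos by simp
    have "norm s \<le> \<bar>Re s\<bar> + \<bar>Im s\<bar>" by (rule cmod_le)
    also have "\<bar>Im s\<bar> \<le> 1/\<epsilon> * exp (\<epsilon> * \<bar>Im s\<bar>)"
    proof -
      have "\<epsilon> * \<bar>Im s\<bar> \<le> exp (\<epsilon> * \<bar>Im s\<bar>)" using e by linarith
      then show ?thesis using pos by (simp add: field_simps)
    qed
    also have "\<bar>Re s\<bar> \<le> max \<bar>x1\<bar> \<bar>x2\<bar> * exp (\<epsilon> * \<bar>Im s\<bar>)"
    proof -
      have "\<bar>Re s\<bar> \<le> max \<bar>x1\<bar> \<bar>x2\<bar> * 1" using s by auto
      also have "\<dots> \<le> max \<bar>x1\<bar> \<bar>x2\<bar> * exp (\<epsilon> * \<bar>Im s\<bar>)" using e1 by (intro mult_left_mono) auto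
      finally show ?thesis .
    qed
    finally show "norm s \<le> (max \<bar>x1\<bar> \<bar>x2\<bar> + 1/\<epsilon>) * exp ((0 + \<epsilon>) * \<bar>Im s\<bar>)"
      by (simp add: algebra_simps)
  qed (use pos in auto)
qed

lemma vertical_growth_inverse_ident: "vertical_growth x1 x2 (\<lambda>s. inverse s) 0"
proof (rule vertical_growth_bounded, intro exI allI impI)
  fix \<delta> :: real and s :: complex assume "\<delta> > 0" and s: "x1 \<le> Re s \<and> Re s \<le> x2 \<and> \<delta> \<le> \<bar>Im s\<bar>"
  then show "norm (inverse s) \<le> inverse \<delta>"
    using abs_Im_le_cmod[of s] unfolding norm_inverse by (intro le_imp_inverse_le) auto
qed

lemma vertical_growth_translate:
  assumes "vertical_growth (x1 + c) (x2 + c) f \<theta>"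
  shows "vertical_growth x1 x2 (\<lambda>s. f (s + of_real c)) \<theta>"
proof (rule vertical_growthI)
  fix \<delta> \<epsilon> :: real assume pos: "\<delta> > 0" "\<epsilon> > 0"
  obtain K where K: "K \<ge> 0" "\<And>s. x1 + c \<le> Re s \<Longrightarrow> Re s \<le> x2 + c \<Longrightarrow> \<delta> \<le> \<bar>Im s\<bar> \<Longrightarrow>
     norm (f s) \<le> K * exp ((\<theta> + \<epsilon>) * \<bar>Im s\<bar>)"
    using vertical_growthE[OF assms pos] by auto
  show "\<exists>K\<ge>0. \<forall>s. x1 \<le> Re s \<and> Re s \<le> x2 \<and> \<delta> \<le> \<bar>Im s\<bar> \<longrightarrow>
     norm (f (s + of_real c)) \<le> K * exp ((\<theta> + \<epsilon>) * \<bar>Im s\<bar>)"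
    using K(1) K(2)[of "_ + of_real c"] by (intro exI[of _ K]) auto
qed

text \<open>Multiplying by \<open>a\<close> stretches imaginary parts by
  \<open>\<bar>a\<bar>\<close>, so \<open>\<delta>\<close> and \<open>\<epsilon>\<close> are
  rescaled accordingly. The growth of \<open>f\<close> is assumed on all strips because the image
  strip depends on \<open>a\<close> and \<open>b\<close>.\<close>

lemma vertical_growth_affine:
  assumes "\<And>y1 y2. vertical_growth y1 y2 f \<theta>" "a \<noteq> 0"
  shows "vertical_growth x1 x2 (\<lambda>s. f (of_real a * s + of_real b)) (\<bar>a\<bar> * \<theta>)"
proof (rule vertical_growthI)
  fix \<delta> \<epsilon> :: real assume pos: "\<delta> > 0" "\<epsilon> > 0"
  define M where "M = \<bar>a\<bar> * max \<bar>x1\<bar> \<bar>x2\<bar> + \<bar>b\<bar>"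
  obtain K where K: "K \<ge> 0" "\<And>s. -M \<le> Re s \<Longrightarrow> Re s \<le> M \<Longrightarrow> \<bar>a\<bar> * \<delta> \<le> \<bar>Im s\<bar> \<Longrightarrow>
     norm (f s) \<le> K * exp ((\<theta> + \<epsilon> / \<bar>a\<bar>) * \<bar>Im s\<bar>)"
    using vertical_growthE[OF assms(1)[of "-M" M], of "\<bar>a\<bar> * \<delta>" "\<epsilon> / \<bar>a\<bar>"] pos assms(2) by auto
  show "\<exists>K\<ge>0. \<forall>s. x1 \<le> Re s \<and> Re s \<le> x2 \<and> \<delta> \<le> \<bar>Im s\<bar> \<longrightarrow>
     norm (f (of_real a * s + of_real b)) \<le> K * exp ((\<bar>a\<bar> * \<theta> + \<epsilon>) * \<bar>Im s\<bar>)"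
  proof (intro exI[of _ K] conjI allI impI)
    fix s assume s: "x1 \<le> Re s \<and> Re s \<le> x2 \<and> \<delta> \<le> \<bar>Im s\<bar>"
    have "\<bar>a * Re s\<bar> \<le> \<bar>a\<bar> * max \<bar>x1\<bar> \<bar>x2\<bar>"
      unfolding abs_mult using s by (intro mult_left_mono) auto
    then have "-M \<le> a * Re s + b" "a * Re s + b \<le> M"
      unfolding M_def by linarith+
    then have "norm (f (of_real a * s + of_real b)) \<le>
        K * exp ((\<theta> + \<epsilon> / \<bar>a\<bar>) * \<bar>Im (of_real a * s + of_real b)\<bar>)"
      using s pos by (intro K) (auto simp: abs_mult intro!: mult_left_mono)
    also have "(\<theta> + \<epsilon> / \<bar>a\<bar>) * \<bar>Im (of_real a * s + of_real b)\<bar> = (\<bar>a\<bar> * \<theta> + \<epsilon>) * \<bar>Im s\<bar>"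
      using assms(2) by (simp add: abs_mult field_simps)
    finally show "norm (f (of_real a * s + of_real b)) \<le> K * exp ((\<bar>a\<bar> * \<theta> + \<epsilon>) * \<bar>Im s\<bar>)" .
  qed (use K in auto)
qed

lemma vertical_growth_join:
  assumes "vertical_growth x1 x2 f \<theta>" "vertical_growth x2 x3 f \<theta>"
  shows "vertical_growth x1 x3 f \<theta>"
proof (rule vertical_growthI)
  fix \<delta> \<epsilon> :: real assume pos: "\<delta> > 0" "\<epsilon> > 0"
  obtain K where K: "K \<ge> 0" "\<And>s. x1 \<le> Re s \<Longrightarrow> Re s \<le> x2 \<Longrightarrow> \<delta> \<le> \<bar>Im s\<bar> \<Longrightarrow>
     norm (f s) \<le> K * exp ((\<theta> + \<epsilon>) * \<bar>Im s\<bar>)"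
    using vertical_growthE[OF assms(1) pos] by auto
  obtain L where L: "L \<ge> 0" "\<And>s. x2 \<le> Re s \<Longrightarrow> Re s \<le> x3 \<Longrightarrow> \<delta> \<le> \<bar>Im s\<bar> \<Longrightarrow>
     norm (f s) \<le> L * exp ((\<theta> + \<epsilon>) * \<bar>Im s\<bar>)"
    using vertical_growthE[OF assms(2) pos] by auto
  show "\<exists>K\<ge>0. \<forall>s. x1 \<le> Re s \<and> Re s \<le> x3 \<and> \<delta> \<le> \<bar>Im s\<bar> \<longrightarrow>
     norm (f s) \<le> K * exp ((\<theta> + \<epsilon>) * \<bar>Im s\<bar>)"
  proof (intro exI[of _ "K + L"] conjI allI impI)
    fix s assume s: "x1 \<le> Re s \<and> Re s \<le> x3 \<and> \<delta> \<le> \<bar>Im s\<bar>"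
    let ?e = "exp ((\<theta> + \<epsilon>) * \<bar>Im s\<bar>)"
    have "norm (f s) \<le> K * ?e \<or> norm (f s) \<le> L * ?e"
      using K(2)[of s] L(2)[of s] s by linarith
    moreover have "K * ?e \<ge> 0" "L * ?e \<ge> 0" using K L by auto
    ultimately show "norm (f s) \<le> (K + L) * ?e" unfolding distrib_right by linarith
  qed (use K L in auto)
qed

text \<open>Agreement off the real axis is enough because \<open>\<delta> > 0\<close>. The
  conventional value 0 of Gamma at its poles and the removal of singularities thus never interfere
  with growth estimates.\<close>

lemma vertical_growth_cong:
  assumes "vertical_growth x1 x2 f \<theta>" "\<And>s. Im s \<noteq> 0 \<Longrightarrow> f s = g s"
  shows "vertical_growth x1 x2 g \<theta>"
  unfolding vertical_growth_def
proof (intro allI impI)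
  fix \<delta> \<epsilon> :: real assume pos: "\<delta> > 0" "\<epsilon> > 0"
  from vertical_growthE[OF assms(1) pos] obtain K where "K \<ge> 0" and
    K: "\<And>s. x1 \<le> Re s \<Longrightarrow> Re s \<le> x2 \<Longrightarrow> \<delta> \<le> \<bar>Im s\<bar> \<Longrightarrow> norm (f s) \<le> K * exp ((\<theta> + \<epsilon>) * \<bar>Im s\<bar>)"
    by blast
  have "norm (g s) \<le> K * exp ((\<theta> + \<epsilon>) * \<bar>Im s\<bar>)"
    if "x1 \<le> Re s \<and> Re s \<le> x2 \<and> \<delta> \<le> \<bar>Im s\<bar>" for s
    using K[of s] assms(2)[of s] that pos by auto
  with \<open>K \<ge> 0\<close> show "\<exists>K\<ge>0. \<forall>s. x1 \<le> Re s \<and> Re s \<le> x2 \<and> \<delta> \<le> \<bar>Im s\<bar> \<longrightarrow>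
      norm (g s) \<le> K * exp ((\<theta> + \<epsilon>) * \<bar>Im s\<bar>)" by blast
qed

lemma vertical_growth_subset:
  "vertical_growth x1 x2 f \<theta> \<Longrightarrow> x1 \<le> y1 \<Longrightarrow> y2 \<le> x2 \<Longrightarrow> vertical_growth y1 y2 f \<theta>"
  unfolding vertical_growth_def by (meson order_trans)

text \<open>
  In Gauss's product each factor \<open>|(x + k) / (x + k + iu)|\<close> is increasing in \<open>x\<close>.
\<close>

lemma norm_Gamma_ratio_mono:
  fixes x y u :: real
  assumes "0 < x" "x \<le> y"
  shows "norm (Gamma (Complex x u)) * Gamma y \<le> norm (Gamma (Complex y u)) * Gamma x"
proof (rule LIMSEQ_le)
  show "(\<lambda>n. norm (Gamma_series (Complex x u) n) * Gamma_series y n) \<longlonglongrightarrow> norm (Gamma (Complex x u)) * Gamma y"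
       "(\<lambda>n. norm (Gamma_series (Complex y u) n) * Gamma_series x n) \<longlonglongrightarrow> norm (Gamma (Complex y u)) * Gamma x"
    by (intro tendsto_intros)+
  have "norm (Gamma_series (Complex x u) n) * Gamma_series y n \<le>
        norm (Gamma_series (Complex y u) n) * Gamma_series x n" for n
  proof -
    \<comment> \<open>The common numerator of both sides: \<open>\<bar>exp (z * ln n)\<bar>\<close>
      depends on \<open>Re z\<close> only, so just the Pochhammer products have to be
      compared.\<close>
    define A where "A = fact n * exp (x * ln (real n)) * (fact n * exp (y * ln (real n)))"
    have *: "(x + k) * norm (Complex y u + of_nat k) \<le> (y + k) * norm (Complex x u + of_nat k)" for k :: nat
    proof (rule power2_le_imp_le)
      \<comment> \<open>After squaring, both sides of the claim share the term
        \<open>(x + k)\<^sup>2 * (y + k)\<^sup>2\<close>; this inequality is what remains.\<close>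
      have "((x + k) * u)\<^sup>2 \<le> ((y + k) * u)\<^sup>2"
        using assms by (simp add: power_mult_distrib mult_right_mono power_mono)
      then show "((x + k) * norm (Complex y u + of_nat k))\<^sup>2 \<le> ((y + k) * norm (Complex x u + of_nat k))\<^sup>2"
        unfolding power_mult_distrib cmod_power2 by (simp add: algebra_simps)
    qed (use assms in auto)
    have "(\<Prod>k<Suc n. (x + k) * norm (Complex y u + of_nat k)) \<le> (\<Prod>k<Suc n. (y + k) * norm (Complex x u + of_nat k))"
      using * assms by (intro prod_mono) auto
    then have "pochhammer x (Suc n) * norm (pochhammer (Complex y u) (Suc n)) \<le>
               pochhammer y (Suc n) * norm (pochhammer (Complex x u) (Suc n))"
      by (simp only: pochhammer_prod atLeast0LessThan prod.distrib prod_norm)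
    moreover have "pochhammer x (Suc n) > 0" "pochhammer y (Suc n) > 0"
      using assms by (auto intro!: pochhammer_pos)
    moreover have "norm (pochhammer (Complex x u) (Suc n)) > 0" "norm (pochhammer (Complex y u) (Suc n)) > 0"
      unfolding zero_less_norm_iff pochhammer_eq_0_iff using assms by (auto simp: complex_eq_iff)
    moreover have "A > 0" by (simp add: A_def)
    ultimately have "A / (norm (pochhammer (Complex x u) (Suc n)) * pochhammer y (Suc n)) \<le>
          A / (norm (pochhammer (Complex y u) (Suc n)) * pochhammer x (Suc n))"
      by (intro divide_left_mono) (auto simp: mult.commute)
    then show ?thesis
      by (simp add: Gamma_series_def A_def norm_divide norm_mult mult_ac)
  qed
  then show "\<exists>N. \<forall>n\<ge>N. norm (Gamma_series (Complex x u) n) * Gamma_series y n \<le>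
        norm (Gamma_series (Complex y u) n) * Gamma_series x n" by blast
qed

text \<open>Reflection formula at \<open>z = \<i> * u\<close>: since \<open>1 - z\<close> is the
  conjugate of \<open>1 + z\<close>, the product of the two Gamma values has modulus equal to the
  square of one of them, and the sine becomes a hyperbolic sine.\<close>

lemma norm_Gamma_one_plus:
  fixes u :: real
  assumes "u \<noteq> 0"
  shows "(norm (Gamma (Complex 1 u)))\<^sup>2 = pi * \<bar>u\<bar> / sinh (pi * \<bar>u\<bar>)"
proof -
  define z where "z = \<i> * complex_of_real u"
  have z: "z \<notin> \<int>\<^sub>\<le>\<^sub>0" "Complex 1 u = z + 1" "cnj (z + 1) = 1 - z"
    using assms by (auto simp: z_def complex_eq_iff elim!: nonpos_Ints_cases)
  have "Gamma (z + 1) * Gamma (1 - z) = z * (Gamma z * Gamma (1 - z))"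
    using z by (simp add: Gamma_plus1)
  also have "\<dots> = z * (of_real pi / sin (of_real pi * z))"
    by (subst Gamma_reflection_complex) simp
  finally have "norm (Gamma (z + 1)) * norm (Gamma (1 - z)) = norm z * (pi / norm (sin (of_real pi * z)))"
    by (metis norm_divide norm_mult norm_of_real abs_of_pos pi_gt_zero)
  moreover have "norm (Gamma (1 - z)) = norm (Gamma (z + 1))"
    unfolding z(3)[symmetric] cnj_Gamma[symmetric] complex_mod_cnj ..
  moreover have "norm (sin (of_real pi * z)) = sinh (pi * \<bar>u\<bar>)"
  proof -
    have "sin (of_real pi * z) = - \<i> * sinh (\<i> * (of_real pi * z))"
      by (rule sin_conv_sinh)
    also have "\<i> * (of_real pi * z) = of_real (- pi * u)" by (simp add: z_def complex_eq_iff)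
    finally have "norm (sin (of_real pi * z)) = \<bar>sinh (- pi * u)\<bar>"
      by (simp only: norm_mult norm_minus_cancel norm_ii) (simp add: sinh_def scaleR_conv_of_real exp_of_real flip: of_real_diff of_real_minus of_real_mult)
    then show ?thesis by (simp add: abs_mult sinh_real_abs[symmetric])
  qed
  ultimately show ?thesis using z by (simp add: power2_eq_square z_def norm_mult)
qed

text \<open>The exact formula settles \<open>Re s = 1\<close>, and the recurrence carries it to
  \<open>Re s = 2\<close>. By \<open>norm_Gamma_ratio_mono\<close> the right edge bounds Gamma from
  above inside the strip and the left edge bounds it from below, up to real Gamma values that are
  bounded on [1, 2].\<close>

lemma vertical_growth_Gamma_1_2:
  "vertical_growth 1 2 Gamma (- pi / 2)" "vertical_growth 1 2 rGamma (pi / 2)"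
proof -
  have "bounded (Gamma ` {1..2::real})"
    by (intro compact_imp_bounded compact_continuous_image continuous_on_Gamma continuous_on_id)
       (auto elim!: nonpos_Ints_cases)
  then obtain B where B: "\<And>x. x \<in> {1..2::real} \<Longrightarrow> Gamma x \<le> B"
    unfolding bounded_iff by fastforce
  have "bounded (rGamma ` {1..2::real})"
    by (intro compact_imp_bounded compact_continuous_image continuous_on_rGamma continuous_on_id) auto
  then obtain b where b: "b > 0" "\<And>x. x \<in> {1..2::real} \<Longrightarrow> rGamma x \<le> b"
    unfolding bounded_pos by (auto simp: abs_le_iff)
  have G1: "vertical_growth 1 1 Gamma (- pi / 2)"
  proof (rule vertical_growthI)
    fix \<delta> \<epsilon> :: real assume pos: "\<delta> > 0" "\<epsilon> > 0"
    \<comment> \<open>From \<open>2 * sinh v = exp v * (1 - exp (- 2 * v))\<close> with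
      \<open>v \<ge> pi * \<delta>\<close>: the bracket is at least \<open>q\<close>.\<close>
    define q where "q = 1 - exp (- (2 * pi * \<delta>))"
    have q: "q > 0" using pos by (simp add: q_def)
    show "\<exists>K\<ge>0. \<forall>s. 1 \<le> Re s \<and> Re s \<le> 1 \<and> \<delta> \<le> \<bar>Im s\<bar> \<longrightarrow>
      norm (Gamma s) \<le> K * exp ((- pi / 2 + \<epsilon>) * \<bar>Im s\<bar>)"
    proof (intro exI[of _ "sqrt (pi / (q * \<epsilon>))"] conjI allI impI)
      show "0 \<le> sqrt (pi / (q * \<epsilon>))" using q pos by simp
      fix s assume s: "1 \<le> Re s \<and> Re s \<le> 1 \<and> \<delta> \<le> \<bar>Im s\<bar>"
      define u where "u = Im s"
      have u: "\<delta> \<le> \<bar>u\<bar>" and su: "s = Complex 1 u"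
        using s by (auto simp: u_def complex_eq_iff)
      have "exp (- (2 * pi * \<bar>u\<bar>)) \<le> exp (- (2 * pi * \<delta>))" using u by simp
      then have "exp (pi * \<bar>u\<bar>) * q \<le> exp (pi * \<bar>u\<bar>) * (1 - exp (- (2 * pi * \<bar>u\<bar>)))"
        unfolding q_def by (intro mult_left_mono) auto
      also have "\<dots> = 2 * sinh (pi * \<bar>u\<bar>)"
        by (simp add: sinh_def right_diff_distrib flip: exp_add)
      finally have sh: "exp (pi * \<bar>u\<bar>) * q / 2 \<le> sinh (pi * \<bar>u\<bar>)" by simp
      \<comment> \<open>The factor \<open>\<bar>u\<bar>\<close> is traded for
        \<open>exp (2 * \<epsilon> * \<bar>u\<bar>)\<close>; the 2 is there because the square of
        the modulus is being estimated.\<close>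
      have "1 + 2 * \<epsilon> * \<bar>u\<bar> \<le> exp (2 * \<epsilon> * \<bar>u\<bar>)" by (rule exp_ge_add_one_self)
      then have "2 * \<epsilon> * \<bar>u\<bar> \<le> exp (2 * \<epsilon> * \<bar>u\<bar>)" by linarith
      then have ub: "\<bar>u\<bar> \<le> exp (2 * \<epsilon> * \<bar>u\<bar>) / (2 * \<epsilon>)" using pos by (simp add: field_simps)
      have "(norm (Gamma s))\<^sup>2 = pi * \<bar>u\<bar> / sinh (pi * \<bar>u\<bar>)"
        unfolding su using u pos by (subst norm_Gamma_one_plus) auto
      also have "\<dots> \<le> pi * \<bar>u\<bar> / (exp (pi * \<bar>u\<bar>) * q / 2)"
        using u pos q sh by (intro divide_left_mono mult_pos_pos) auto
      also have "\<dots> \<le> pi * (exp (2 * \<epsilon> * \<bar>u\<bar>) / (2 * \<epsilon>)) / (exp (pi * \<bar>u\<bar>) * q / 2)"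
        using ub q by (intro divide_right_mono mult_left_mono) auto
      also have "\<dots> = pi / (q * \<epsilon>) * (exp (2 * \<epsilon> * \<bar>u\<bar>) * exp (- (pi * \<bar>u\<bar>)))"
        using q pos by (simp add: exp_minus field_simps)
      also have "\<dots> = (sqrt (pi / (q * \<epsilon>)))\<^sup>2 * (exp ((- pi / 2 + \<epsilon>) * \<bar>u\<bar>))\<^sup>2"
        using q pos by (simp add: algebra_simps flip: exp_add exp_double)
      finally have "(norm (Gamma s))\<^sup>2 \<le> (sqrt (pi / (q * \<epsilon>)) * exp ((- pi / 2 + \<epsilon>) * \<bar>u\<bar>))\<^sup>2"
        by (simp only: power_mult_distrib)
      then show "norm (Gamma s) \<le> sqrt (pi / (q * \<epsilon>)) * exp ((- pi / 2 + \<epsilon>) * \<bar>Im s\<bar>)"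
        unfolding u_def by (rule power2_le_imp_le) (use q pos in auto)
    qed
  qed
  have G2: "vertical_growth 2 2 Gamma (- pi / 2)"
  proof (rule vertical_growth_cong)
    show "vertical_growth 2 2 (\<lambda>s. Gamma (s + of_real (-1)) * (s + of_real (-1))) (- pi / 2)"
      using vertical_growth_translate[of 2 "-1" 2, OF vertical_growth_mult[OF G1[THEN vertical_growth_subset] vertical_growth_ident]] by simp
    show "Gamma (s + of_real (-1)) * (s + of_real (-1)) = Gamma s" if "Im s \<noteq> 0" for s
    proof -
      have "s - 1 \<notin> \<int>\<^sub>\<le>\<^sub>0" using that by (auto elim!: nonpos_Ints_cases simp: complex_eq_iff)
      then show ?thesis using Gamma_plus1[of "s - 1"] by (simp add: mult.commute)
    qed
  qed
  show "vertical_growth 1 2 Gamma (- pi / 2)"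
  proof (rule vertical_growthI)
    fix \<delta> \<epsilon> :: real assume pos: "\<delta> > 0" "\<epsilon> > 0"
    obtain K where K: "K \<ge> 0" "\<And>s. 2 \<le> Re s \<Longrightarrow> Re s \<le> 2 \<Longrightarrow> \<delta> \<le> \<bar>Im s\<bar> \<Longrightarrow>
        norm (Gamma s) \<le> K * exp ((- pi / 2 + \<epsilon>) * \<bar>Im s\<bar>)"
      using vertical_growthE[OF G2 pos] by blast
    have B0: "B \<ge> 0" using B[of 1] by simp
    show "\<exists>K\<ge>0. \<forall>s. 1 \<le> Re s \<and> Re s \<le> 2 \<and> \<delta> \<le> \<bar>Im s\<bar> \<longrightarrow>
      norm (Gamma s) \<le> K * exp ((- pi / 2 + \<epsilon>) * \<bar>Im s\<bar>)"
    proof (intro exI[of _ "K * B"] conjI allI impI)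
      fix s assume s: "1 \<le> Re s \<and> Re s \<le> 2 \<and> \<delta> \<le> \<bar>Im s\<bar>"
      \<comment> \<open>Monotonicity between \<open>Re s\<close> and 2, where the real factor is
        \<open>Gamma 2 = 1\<close>.\<close>
      have "norm (Gamma s) \<le> norm (Gamma (Complex 2 (Im s))) * Gamma (Re s)"
        using norm_Gamma_ratio_mono[of "Re s" 2 "Im s"] s Gamma_fact[of 1, where ?'a = real] by simp
      also have "\<dots> \<le> K * exp ((- pi / 2 + \<epsilon>) * \<bar>Im s\<bar>) * B"
        using s K(1) K(2)[of "Complex 2 (Im s)"] B[of "Re s"] Gamma_real_pos[of "Re s"]
        by (intro mult_mono) auto
      finally show "norm (Gamma s) \<le> K * B * exp ((- pi / 2 + \<epsilon>) * \<bar>Im s\<bar>)" by (simp add: mult_ac)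
    qed (use K B0 in auto)
  qed
  show "vertical_growth 1 2 rGamma (pi / 2)"
  proof (rule vertical_growthI)
    fix \<delta> \<epsilon> :: real assume pos: "\<delta> > 0" "\<epsilon> > 0"
    show "\<exists>K\<ge>0. \<forall>s. 1 \<le> Re s \<and> Re s \<le> 2 \<and> \<delta> \<le> \<bar>Im s\<bar> \<longrightarrow>
      norm (rGamma s) \<le> K * exp ((pi / 2 + \<epsilon>) * \<bar>Im s\<bar>)"
    proof (intro exI[of _ "b / sqrt (2 * pi * \<delta>)"] conjI allI impI)
      show "0 \<le> b / sqrt (2 * pi * \<delta>)" using b pos by simp
      fix s assume s: "1 \<le> Re s \<and> Re s \<le> 2 \<and> \<delta> \<le> \<bar>Im s\<bar>"
      define x u where "x = Re s" and "u = Im s"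
      have x: "x \<in> {1..2}" and u: "\<delta> \<le> \<bar>u\<bar>" and su: "s = Complex x u"
        using s by (auto simp: x_def u_def)
      \<comment> \<open>The lower bound rests on \<open>\<bar>u\<bar> \<ge> \<delta>\<close> and, in
        the next step, on \<open>sinh v \<le> exp v / 2\<close>.\<close>
      have "2 * pi * \<delta> * exp (- (pi * \<bar>u\<bar>)) \<le> pi * \<bar>u\<bar> / (exp (pi * \<bar>u\<bar>) / 2)"
        using u pos by (simp add: exp_minus field_simps)
      also have "\<dots> \<le> pi * \<bar>u\<bar> / sinh (pi * \<bar>u\<bar>)"
        using u pos by (intro divide_left_mono) (auto simp: sinh_def)
      also have "\<dots> = (norm (Gamma (Complex 1 u)))\<^sup>2"
        using u pos by (subst norm_Gamma_one_plus) auto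
      finally have G1: "2 * pi * \<delta> * exp (- (pi * \<bar>u\<bar>)) \<le> (norm (Gamma (Complex 1 u)))\<^sup>2" .
      \<comment> \<open>Monotonicity between 1 and \<open>x\<close>, now with
        \<open>Gamma 1 = 1\<close>.\<close>
      have "norm (Gamma (Complex 1 u)) \<le> norm (Gamma s) * rGamma x"
        using norm_Gamma_ratio_mono[of 1 x u] x Gamma_real_pos[of x]
        by (simp add: su rGamma_inverse_Gamma field_simps)
      also have "norm (Gamma s) * rGamma x \<le> norm (Gamma s) * b"
        using b x by (intro mult_left_mono) auto
      finally have G1s: "norm (Gamma (Complex 1 u)) \<le> norm (Gamma s) * b" .
      have "sqrt (2 * pi * \<delta> * exp (- (pi * \<bar>u\<bar>))) \<le> norm (Gamma s) * b"
        using b by (intro real_le_lsqrt order_trans[OF G1 power_mono[OF G1s]]) auto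
      moreover have "sqrt (exp (- (pi * \<bar>u\<bar>))) = exp (- (pi / 2 * \<bar>u\<bar>))"
        by (rule real_sqrt_unique) (auto simp flip: exp_double)
      ultimately have *: "sqrt (2 * pi * \<delta>) * exp (- (pi / 2 * \<bar>u\<bar>)) \<le> norm (Gamma s) * b"
        by (simp add: real_sqrt_mult)
      moreover have "sqrt (2 * pi * \<delta>) * exp (- (pi / 2 * \<bar>u\<bar>)) > 0" using pos by simp
      ultimately have "norm (Gamma s) > 0" using b by (metis less_le_trans zero_less_mult_pos2)
      with * b pos have "norm (rGamma s) \<le> b / sqrt (2 * pi * \<delta>) * exp (pi / 2 * \<bar>u\<bar>)"
        by (simp add: rGamma_inverse_Gamma norm_inverse exp_minus norm_divide field_simps)
      also have "\<dots> \<le> b / sqrt (2 * pi * \<delta>) * exp ((pi / 2 + \<epsilon>) * \<bar>u\<bar>)"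
        using b pos by (intro mult_left_mono) (auto simp: distrib_right)
      finally show "norm (rGamma s) \<le> b / sqrt (2 * pi * \<delta>) * exp ((pi / 2 + \<epsilon>) * \<bar>Im s\<bar>)"
        by (simp add: u_def)
    qed
  qed
qed

text \<open>Each induction step widens the strip by one unit on both sides: the known strip is
  shifted left and right by the recurrence, whose factors \<open>s\<close>, \<open>s - 1\<close> or
  their inverses have growth exponent 0, and the pieces are joined.\<close>

lemma vertical_growth_Gamma_aux:
  "vertical_growth (1 - real n) (2 + real n) Gamma (- pi / 2) \<and>
   vertical_growth (1 - real n) (2 + real n) rGamma (pi / 2)"
proof (induction n)
  case 0
  then show ?case using vertical_growth_Gamma_1_2 by simp
next
  case (Suc n)
  have nz: "z \<notin> \<int>\<^sub>\<le>\<^sub>0" if "Im z \<noteq> 0" for z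
    using that by (auto elim!: nonpos_Ints_cases)
  let ?l = "1 - real n" and ?r = "2 + real n"
  note G = Suc.IH[THEN conjunct1] and R = Suc.IH[THEN conjunct2]
  have Gl: "vertical_growth (?l - 1) (?r - 1) Gamma (- pi / 2)"
  proof (rule vertical_growth_cong)
    show "vertical_growth (?l - 1) (?r - 1) (\<lambda>s. Gamma (s + of_real 1) * inverse s) (- pi / 2)"
      using vertical_growth_mult[OF vertical_growth_translate[of _ 1] vertical_growth_inverse_ident] G by simp
  qed (use nz in \<open>auto simp: Gamma_plus1 field_simps\<close>)
  have Rl: "vertical_growth (?l - 1) (?r - 1) rGamma (pi / 2)"
  proof (rule vertical_growth_cong)
    show "vertical_growth (?l - 1) (?r - 1) (\<lambda>s. rGamma (s + of_real 1) * s) (pi / 2)"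
      using vertical_growth_mult[OF vertical_growth_translate[of _ 1] vertical_growth_ident] R by simp
  qed (simp add: rGamma_plus1 mult.commute)
  have Gr: "vertical_growth (?l + 1) (?r + 1) Gamma (- pi / 2)"
  proof (rule vertical_growth_cong)
    show "vertical_growth (?l + 1) (?r + 1) (\<lambda>s. Gamma (s + of_real (-1)) * (s + of_real (-1))) (- pi / 2)"
      using vertical_growth_translate[of _ "-1", OF vertical_growth_mult[OF G[THEN vertical_growth_subset] vertical_growth_ident]] by simp
    show "Gamma (s + of_real (-1)) * (s + of_real (-1)) = Gamma s" if "Im s \<noteq> 0" for s
      using Gamma_plus1[of "s - 1"] nz[of "s - 1"] that by (simp add: mult.commute)
  qed
  have Rr: "vertical_growth (?l + 1) (?r + 1) rGamma (pi / 2)"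
  proof (rule vertical_growth_cong)
    show "vertical_growth (?l + 1) (?r + 1) (\<lambda>s. rGamma (s + of_real (-1)) * inverse (s + of_real (-1))) (pi / 2)"
      using vertical_growth_translate[of _ "-1", OF vertical_growth_mult[OF R[THEN vertical_growth_subset] vertical_growth_inverse_ident]] by simp
    show "rGamma (s + of_real (-1)) * inverse (s + of_real (-1)) = rGamma s" if "Im s \<noteq> 0" for s
    proof -
      have "rGamma (s - 1) = (s - 1) * rGamma s" using rGamma_plus1[of "s - 1"] by simp
      moreover have "s - 1 \<noteq> 0" using that by auto
      ultimately show ?thesis by (simp add: field_simps)
    qed
  qed
  have *: "1 - real (Suc n) = ?l - 1" "2 + real (Suc n) = ?r + 1" by simp_all
  have "vertical_growth (?l - 1) (?r + 1) Gamma (- pi / 2)"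
    by (intro vertical_growth_join[OF vertical_growth_join[of "?l - 1" ?l _ _ ?r], where ?x3.0 = "?r + 1"] G
          vertical_growth_subset[OF Gl] vertical_growth_subset[OF Gr]) auto
  moreover have "vertical_growth (?l - 1) (?r + 1) rGamma (pi / 2)"
    by (intro vertical_growth_join[OF vertical_growth_join[of "?l - 1" ?l _ _ ?r], where ?x3.0 = "?r + 1"] R
          vertical_growth_subset[OF Rl] vertical_growth_subset[OF Rr]) auto
  ultimately show ?case unfolding * by blast
qed

lemma vertical_growth_Gamma: "vertical_growth x1 x2 Gamma (- pi / 2)"
  and vertical_growth_rGamma: "vertical_growth x1 x2 rGamma (pi / 2)"
proof -
  obtain n :: nat where "max \<bar>x1\<bar> \<bar>x2\<bar> + 1 \<le> real n" using real_arch_simple by blast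
  then have n: "1 - real n \<le> x1" "x2 \<le> 2 + real n" by auto
  show "vertical_growth x1 x2 Gamma (- pi / 2)" "vertical_growth x1 x2 rGamma (pi / 2)"
    using vertical_growth_Gamma_aux[of n] by (auto intro: vertical_growth_subset[OF _ n])
qed

section \<open>Fourier inversion and tilting\<close>

text \<open>The right-hand side is the kernel of Levy's inversion formula; as an integral over
  \<open>x\<close> it becomes accessible to Fubini. At \<open>t = 0\<close> division by zero would
  yield 0 instead of \<open>b - a\<close>.\<close>

lemma iexp_integral_Icc:
  fixes a b t :: real
  assumes "a \<le> b" "t \<noteq> 0"
  shows "(\<integral>x. indicator {a..b} x *\<^sub>R iexp (- (t * x)) \<partial>lborel) = (iexp (- (t * a)) - iexp (- (t * b))) / (\<i> * t)"
proof -
  have "(\<integral>x. indicator {a..b} x *\<^sub>R iexp (- (t * x)) \<partial>lborel)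
      = \<i> / of_real t * iexp (- (t * b)) - \<i> / of_real t * iexp (- (t * a))"
  proof (rule integral_FTC_atLeastAtMost)
    fix x :: real
    have "((\<lambda>z. \<i> / of_real t * exp (- (\<i> * (of_real t * z)))) has_field_derivative iexp (- (t * x))) (at (of_real x))"
      using assms(2) by (auto intro!: derivative_eq_intros)
    from has_vector_derivative_real_field[OF this]
    show "((\<lambda>x. \<i> / of_real t * iexp (- (t * x))) has_vector_derivative iexp (- (t * x))) (at x within {a..b})"
      by simp
  qed (use assms in \<open>auto intro!: continuous_intros\<close>)
  also have "\<dots> = (iexp (- (t * a)) - iexp (- (t * b))) / (\<i> * t)"
    using assms(2) by (simp add: field_simps)
  finally show ?thesis .
qed

lemma continuous_on_fourier:
  assumes "integrable lborel (\<phi> :: real \<Rightarrow> complex)"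
  shows "continuous_on UNIV (\<lambda>x. CLINT t|lborel. iexp (- (t * x)) * \<phi> t)"
proof (rule continuous_at_imp_continuous_on, rule ballI)
  fix x :: real
  have [measurable]: "\<phi> \<in> borel_measurable borel" using borel_measurable_integrable[OF assms] by simp
  show "isCont (\<lambda>x. CLINT t|lborel. iexp (- (t * x)) * \<phi> t) x"
    unfolding continuous_at_sequentially comp_def
  proof (intro allI impI)
    fix X :: "nat \<Rightarrow> real" assume X: "X \<longlonglongrightarrow> x"
    show "(\<lambda>n. CLINT t|lborel. iexp (- (t * X n)) * \<phi> t) \<longlonglongrightarrow> (CLINT t|lborel. iexp (- (t * x)) * \<phi> t)"
    proof (rule integral_dominated_convergence[where w = "\<lambda>t. norm (\<phi> t)"])
      show "AE t in lborel. (\<lambda>n. iexp (- (t * X n)) * \<phi> t) \<longlonglongrightarrow> iexp (- (t * x)) * \<phi> t"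
        by (intro AE_I2 tendsto_intros X)
    qed (use assms in \<open>auto simp: norm_mult\<close>)
  qed
qed

text \<open>Levy's formula gives the mass as a limit of integrals over [-T, T]. Integrability of the
  characteristic function turns this limit into one absolutely convergent integral, and Fubini
  exchanges it with the integral over [a, b] that represents the kernel.\<close>

lemma (in real_distribution) Ioc_eq_fourier_integral:
  assumes int: "integrable lborel (char M)"
    and ab: "a \<le> b" "measure M {a} = 0" "measure M {b} = 0"
  shows "complex_of_real (measure M {a<..b}) =
    (\<integral>x. indicator {a..b} x *\<^sub>R (1 / (2 * pi) * (CLINT t|lborel. iexp (- (t * x)) * char M t)) \<partial>lborel)"
proof -
  define \<psi> where "\<psi> = (\<lambda>t::real. \<integral>x. indicator {a..b} x *\<^sub>R iexp (- (t * x)) \<partial>lborel)"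
  have [measurable]: "char M \<in> borel_measurable borel" by simp
  have [measurable]: "\<psi> \<in> borel_measurable borel" unfolding \<psi>_def by measurable
  have \<psi>_le: "norm (\<psi> t) \<le> b - a" for t
  proof -
    have "norm (\<psi> t) \<le> (\<integral>x. indicator {a..b} x \<partial>lborel)"
      unfolding \<psi>_def by (rule Bochner_Integration.integral_norm_bound_integral)
        (auto intro!: borel_integrable_atLeastAtMost' [unfolded set_integrable_def] continuous_intros
              simp: integrable_indicator_iff ab)
    then show ?thesis using ab by simp
  qed
  \<comment> \<open>The two integrands differ only at \<open>t = 0\<close>, a null set.\<close>
  have AE_eq: "AE t in lborel. (iexp (- (t * a)) - iexp (- (t * b))) / (\<i> * t) * char M t = \<psi> t * char M t"
    using AE_lborel_singleton[of 0]
  proof eventually_elim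
    case (elim t)
    then show ?case unfolding \<psi>_def by (simp only: iexp_integral_Icc[OF ab(1)] not_False_eq_True)
  qed
  have int\<psi>: "integrable lborel (\<lambda>t. \<psi> t * char M t)"
  proof (rule Bochner_Integration.integrable_bound)
    show "integrable lborel (\<lambda>t. (b - a) * norm (char M t))" using int by auto
    show "AE t in lborel. norm (\<psi> t * char M t) \<le> norm ((b - a) * norm (char M t))"
      using \<psi>_le ab by (auto simp: norm_mult intro!: mult_right_mono)
  qed simp
  have lim1: "(\<lambda>T::nat. CLBINT t=-real T..real T. (iexp (- (t * a)) - iexp (- (t * b))) / (\<i> * t) * char M t)
      \<longlonglongrightarrow> (CLINT t|lborel. \<psi> t * char M t)"
  proof -
    have "(\<lambda>T::nat. \<integral>t. indicator {-real T..real T} t *\<^sub>R (\<psi> t * char M t) \<partial>lborel)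
       \<longlonglongrightarrow> (CLINT t|lborel. \<psi> t * char M t)"
    proof (rule integral_dominated_convergence[where w = "\<lambda>t. norm (\<psi> t * char M t)"])
      show "AE t in lborel. (\<lambda>T::nat. indicator {-real T..real T} t *\<^sub>R (\<psi> t * char M t)) \<longlonglongrightarrow> \<psi> t * char M t"
      proof (intro AE_I2 tendsto_eventually)
        fix t :: real
        show "\<forall>\<^sub>F T in sequentially. indicator {-real T..real T} t *\<^sub>R (\<psi> t * char M t) = \<psi> t * char M t"
          using eventually_ge_at_top[of "nat \<lceil>\<bar>t\<bar>\<rceil>"]
          by eventually_elim (auto simp: indicator_def)
      qed
    qed (use int\<psi> in \<open>auto simp: indicator_def\<close>)
    moreover have "(CLBINT t=-real T..real T. (iexp (- (t * a)) - iexp (- (t * b))) / (\<i> * t) * char M t) =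
       (\<integral>t. indicator {-real T..real T} t *\<^sub>R (\<psi> t * char M t) \<partial>lborel)" for T :: nat
    proof -
      have "(CLBINT t=-real T..real T. (iexp (- (t * a)) - iexp (- (t * b))) / (\<i> * t) * char M t) =
        (CLBINT t:{-real T..real T}. (iexp (- (t * a)) - iexp (- (t * b))) / (\<i> * t) * char M t)"
        using interval_integral_Icc[of "-real T" "real T"] by simp
      also have "\<dots> = (\<integral>t. indicator {-real T..real T} t *\<^sub>R (\<psi> t * char M t) \<partial>lborel)"
        unfolding set_lebesgue_integral_def using AE_eq by (intro integral_cong_AE) (measurable, auto)
      finally show ?thesis .
    qed
    ultimately show ?thesis by simp
  qed
  have "(\<lambda>T::nat. 1 / (2 * pi) * (CLBINT t=-real T..real T. (iexp (- (t * a)) - iexp (- (t * b))) / (\<i> * t) * char M t))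
      \<longlonglongrightarrow> 1 / (2 * pi) * (CLINT t|lborel. \<psi> t * char M t)"
    by (intro tendsto_intros lim1)
  moreover have "(\<lambda>T::nat. 1 / (2 * pi) * (CLBINT t=-real T..real T. (iexp (- (t * a)) - iexp (- (t * b))) / (\<i> * t) * char M t))
      \<longlonglongrightarrow> complex_of_real (measure M {a<..b})"
    using Levy_Inversion[OF ab] by simp
  ultimately
have "complex_of_real (measure M {a<..b}) = 1 / (2 * pi) * (CLINT t|lborel. \<psi> t * char M t)"
    using LIMSEQ_unique by blast
  also have "(CLINT t|lborel. \<psi> t * char M t) =
     (CLINT t|lborel. CLINT x|lborel. indicator {a..b} x *\<^sub>R (iexp (- (t * x)) * char M t))"
    unfolding \<psi>_def by (simp flip: integral_mult_left_zero)
  also have "\<dots> = (CLINT x|lborel. CLINT t|lborel. indicator {a..b} x *\<^sub>R (iexp (- (t * x)) * char M t))"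
  proof (rule lborel_pair.Fubini_integral, rule lborel_pair.Fubini_integrable)
    show "integrable lborel (\<lambda>x. \<integral>t. norm (case (x, t) of (x, t) \<Rightarrow> indicator {a..b} x *\<^sub>R (iexp (- (t * x)) * char M t)) \<partial>lborel)"
      by (simp add: norm_mult integrable_indicator_iff ab(1))
    show "AE x in lborel. integrable lborel (\<lambda>t. case (x, t) of (x, t) \<Rightarrow> indicator {a..b} x *\<^sub>R (iexp (- (t * x)) * char M t))"
    proof (rule AE_I2)
      fix x :: real
      show "integrable lborel (\<lambda>t. case (x, t) of (x, t) \<Rightarrow> indicator {a..b} x *\<^sub>R (iexp (- (t * x)) * char M t))"
        by (rule Bochner_Integration.integrable_bound[OF int]) (auto simp: norm_mult indicator_def)
    qed
  qed measurable
  finally show ?thesis by (simp add: scaleR_conv_of_real)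
qed

text \<open>The candidate is the real part of \<open>H\<close>. Levy's formula is available only for
  endpoints without mass, so atoms are excluded first; then continuity forces
  \<open>h \<ge> 0\<close>, and agreement on half-open intervals determines the measure.\<close>

lemma (in real_distribution) integrable_char_density:
  assumes int: "integrable lborel (char M)"
  defines "H \<equiv> \<lambda>x. 1 / (2 * pi) * (CLINT t|lborel. iexp (- (t * x)) * char M t)"
  obtains h where "continuous_on UNIV h" "\<And>x. h x \<ge> 0" "\<And>x. complex_of_real (h x) = H x"
    "M = density lborel (\<lambda>x. ennreal (h x))"
proof -
  have contH: "continuous_on UNIV H" unfolding H_def by (intro continuous_intros continuous_on_fourier int)
  define B where "B = 1 / (2 * pi) * (LINT t|lborel. norm (char M t))"
  have HB: "norm (H x) \<le> B" for x
  proof -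
    have "norm (CLINT t|lborel. iexp (- (t * x)) * char M t) \<le> (LINT t|lborel. norm (char M t))"
      using integral_norm_bound[of lborel "\<lambda>t. iexp (- (t * x)) * char M t"] by (simp add: norm_mult)
    then show ?thesis unfolding H_def B_def norm_mult by (simp add: norm_divide norm_mult divide_right_mono)
  qed
  have B0: "B \<ge> 0" unfolding B_def by (auto intro!: mult_nonneg_nonneg)
  define h where "h = (\<lambda>x. Re (H x))"
  have conth: "continuous_on A h" for A unfolding h_def
    by (intro continuous_intros continuous_on_subset[OF contH]) auto
  have inth: "set_integrable lborel {a..b} h" for a b by (intro borel_integrable_atLeastAtMost' conth)
  have intH: "set_integrable lborel {a..b} H" for a b
    by (intro borel_integrable_atLeastAtMost' continuous_on_subset[OF contH]) auto
  have Ioc0: "measure M {a<..b} = (LINT x:{a..b}|lborel. h x)"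
    if "a \<le> b" "measure M {a} = 0" "measure M {b} = 0" for a b
  proof -
    have "measure M {a<..b} = Re (\<integral>x. indicator {a..b} x *\<^sub>R H x \<partial>lborel)"
      using Ioc_eq_fourier_integral[OF int that] unfolding H_def by (metis Re_complex_of_real)
    also have "\<dots> = (LINT x:{a..b}|lborel. h x)"
      using integral_Re[OF intH[of a b, unfolded set_integrable_def]]
      by (simp add: set_lebesgue_integral_def h_def)
    finally show ?thesis .
  qed
  have hB: "h x \<le> B" for x using HB[of x] complex_Re_le_cmod[of "H x"] unfolding h_def by linarith
  \<comment> \<open>Atoms are countable, so every open interval contains admissible endpoints for
    Levy's formula.\<close>
  have countable: "countable {x. measure M {x} \<noteq> 0}" by (rule countable_support)
  have ex: "\<exists>x\<in>{a<..<b}. measure M {x} = 0" if "a < b" for a b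
  proof (rule ccontr)
    assume "\<not> ?thesis"
    then have "{a<..<b} \<subseteq> {x. measure M {x} \<noteq> 0}" by auto
    then show False using countable uncountable_open_interval[of a b] that countable_subset by blast
  qed
  have atomless: "measure M {x} = 0" for x
  proof (rule ccontr)
    assume "measure M {x} \<noteq> 0"
    then have pos: "measure M {x} > 0" by (simp add: zero_less_measure_iff)
    \<comment> \<open>An interval of length below \<open>2 * e\<close> has mass at most
      \<open>2 * e * B\<close>, hence at most half of the supposed atom; \<open>B + 1\<close> avoids
      division by zero.\<close>
    define e where "e = measure M {x} / (4 * (B + 1))"
    have e: "e > 0" unfolding e_def using pos B0 by simp
    obtain a where a: "a \<in> {x - e<..<x}" "measure M {a} = 0" using ex[of "x - e" x] e by auto
    obtain b where b: "b \<in> {x<..<x + e}" "measure M {b} = 0" using ex[of x "x + e"] e by auto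
    have "measure M {x} \<le> measure M {a<..b}" using a b by (intro finite_measure_mono) auto
    also have "\<dots> = (LINT y:{a..b}|lborel. h y)" using a b by (intro Ioc0) auto
    also have "\<dots> \<le> (LINT y:{a..b}|lborel. B)" using hB by (intro set_integral_mono inth borel_integrable_atLeastAtMost' continuous_on_const) auto
    also have "\<dots> = (b - a) * B" using a b by (simp add: set_lebesgue_integral_def)
    also have "\<dots> \<le> (2 * e) * (B + 1)" using a b B0 by (intro mult_mono) auto
    also have "\<dots> = measure M {x} / 2" unfolding e_def using B0 by (simp add: field_simps)
    finally show False using pos by simp
  qed
  have Ioc: "measure M {a<..b} = (LINT x:{a..b}|lborel. h x)" if "a \<le> b" for a b
    using Ioc0 atomless that by blast
  have h0: "h x \<ge> 0" for x
  proof (rule ccontr)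
    assume "\<not> h x \<ge> 0"
    then have neg: "h x < 0" by simp
    have "\<forall>\<^sub>F y in at x. h y < h x / 2"
      using conth[of UNIV] neg by (intro order_tendstoD(2)[of _ "h x"])
        (auto simp: continuous_on_eq_continuous_at isCont_def)
    then obtain d where d: "d > 0" "\<And>y. y \<noteq> x \<Longrightarrow> dist y x < d \<Longrightarrow> h y < h x / 2"
      unfolding eventually_at by auto
    have "0 \<le> measure M {x<..x + d/2}" by simp
    also have "\<dots> = (LINT y:{x..x + d/2}|lborel. h y)" using d by (intro Ioc) auto
    also have "\<dots> \<le> (LINT y:{x..x + d/2}|lborel. h x / 2)"
    proof (intro set_integral_mono inth borel_integrable_atLeastAtMost' continuous_on_const)
      fix y assume "y \<in> {x..x + d/2}"
      then show "h y \<le> h x / 2" using d(1) d(2)[of y] neg by (cases "y = x") (auto simp: dist_real_def)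
    qed
    also have "\<dots> = d / 2 * (h x / 2)" using d by (simp add: set_lebesgue_integral_def)
    also have "\<dots> < 0" using d neg by (simp add: mult_pos_neg)
    finally show False by simp
  qed
  have meq: "M = density lborel (\<lambda>x. ennreal (h x))"
  proof (rule measure_eqI_generator_eq[where \<Omega>=UNIV and E = "range (\<lambda>(a, b). {a<..b::real})" and A = "\<lambda>i. {- real (i::nat)<..real i}"])
    fix X assume "X \<in> range (\<lambda>(a, b). {a<..b::real})"
    then obtain a b where Xeq: "X = {a<..b}" by auto
    have [measurable]: "h \<in> borel_measurable borel" by (intro borel_measurable_continuous_onI conth)
    show "emeasure M X = emeasure (density lborel (\<lambda>x. ennreal (h x))) X"
    proof (cases "a \<le> b")
      case True
      have "emeasure (density lborel (\<lambda>x. ennreal (h x))) X = (\<integral>\<^sup>+x. ennreal (h x) * indicator {a<..b} x \<partial>lborel)"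
        unfolding Xeq by (intro emeasure_density) auto
      also have "\<dots> = (\<integral>\<^sup>+x. ennreal (indicator {a..b} x * h x) \<partial>lborel)"
        using AE_lborel_singleton[of a] by (intro nn_integral_cong_AE, eventually_elim) (auto simp: indicator_def)
      also have "\<dots> = ennreal (LINT x:{a..b}|lborel. h x)"
        using inth[of a b] h0 unfolding set_integrable_def set_lebesgue_integral_def
        by (subst nn_integral_eq_integral) auto
      also have "\<dots> = emeasure M X" using Ioc[OF True] by (simp add: Xeq emeasure_eq_measure)
      finally show ?thesis ..
    qed (simp add: Xeq)
  next
    show "(\<Union>i. {- real (i::nat)<..real i}) = UNIV" by (rule UN_Ioc_eq_UNIV)
  qed (auto simp: borel_sigma_sets_Ioc Int_stable_def)
  have "complex_of_real (h x) = H x" for x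
  proof -
    let ?f = "\<lambda>t. iexp (- (t * x)) * char M t"
    \<comment> \<open>Conjugation of the integrand is the reflection of \<open>t\<close>, which
      leaves the integral unchanged; hence \<open>H\<close> is real and equals
      \<open>h\<close>.\<close>
    have cc: "char M (- t) = cnj (char M t)" for t
      unfolding char_def by (simp flip: Bochner_Integration.integral_cnj add: exp_cnj)
    have "cnj (\<integral>t. ?f t \<partial>lborel) = (\<integral>t. cnj (?f t) \<partial>lborel)"
      by (rule Bochner_Integration.integral_cnj[symmetric])
    also have "\<dots> = (\<integral>t. ?f (0 + (-1) * t) \<partial>lborel)"
      by (simp add: cc exp_cnj)
    also have "\<dots> = (\<integral>t. ?f t \<partial>lborel)"
      using lborel_integral_real_affine[of "-1" ?f 0] by simp
    finally have "cnj (H x) = H x" unfolding H_def by simp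
    then show ?thesis unfolding h_def by (metis Reals_cnj_iff of_real_Re)
  qed
  with that[of h] conth h0 meq show ?thesis by blast
qed

text \<open>Exponential tilting by \<open>exp (c * Y)\<close> moves the inversion line from \<open>Re s = 0\<close> to \<open>Re s = c\<close>.\<close>

lemma (in prob_space) density_from_exponential_moments:
  fixes Y :: "'a \<Rightarrow> real" and c :: real
  assumes [measurable]: "Y \<in> borel_measurable M"
    and int: "integrable M (\<lambda>\<omega>. exp (c * Y \<omega>))"
  defines "\<Phi> \<equiv> \<lambda>t. CLINT \<omega>|M. exp (Complex c t * Y \<omega>)"
  assumes int\<Phi>: "integrable lborel \<Phi>"
  obtains g where "density_continuous_on M Y UNIV g"
    "\<And>y. complex_of_real (g y) = 1 / (2 * pi) * (CLINT t|lborel. \<Phi> t * exp (- (Complex c t * y)))"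
proof -
  define m where "m = expectation (\<lambda>\<omega>. exp (c * Y \<omega>))"
  have m0: "m \<ge> 0" unfolding m_def by (rule Bochner_Integration.integral_nonneg) auto
  have "m \<noteq> 0"
  proof
    assume "m = 0"
    then have "AE \<omega> in M. exp (c * Y \<omega>) = 0"
      using integral_nonneg_eq_0_iff_AE[OF int] by (simp add: m_def)
    then have "AE \<omega> in M. False" by simp
    then show False using AE_False by simp
  qed
  with m0 have m: "m > 0" by simp
  \<comment> \<open>The tilted law, normalised by \<open>m\<close>; the characteristic function of
    \<open>Y\<close> under it is \<open>\<Phi> / m\<close>.\<close>
  define N where "N = density M (\<lambda>\<omega>. ennreal (exp (c * Y \<omega>) / m))"
  define \<mu> where "\<mu> = distr N borel Y"
  have N: "prob_space N"
  proof (rule prob_spaceI)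
    have "emeasure N (space N) = (\<integral>\<^sup>+\<omega>. ennreal (exp (c * Y \<omega>) / m) \<partial>M)"
      unfolding N_def by (simp add: emeasure_density cong: nn_integral_cong)
    also have "\<dots> = ennreal (expectation (\<lambda>\<omega>. exp (c * Y \<omega>) / m))"
      using int m by (intro nn_integral_eq_integral) auto
    also have "\<dots> = 1" using m by (simp add: m_def)
    finally show "emeasure N (space N) = 1" .
  qed
  have [measurable]: "Y \<in> borel_measurable N" unfolding N_def by simp
  interpret \<mu>: real_distribution \<mu>
    unfolding \<mu>_def by (rule prob_space.real_distribution_distr[OF N]) simp
  have char: "char \<mu> t = \<Phi> t / m" for t
  proof -
    have "char \<mu> t = (CLINT \<omega>|N. iexp (t * Y \<omega>))"
      unfolding char_def \<mu>_def by (subst integral_distr) auto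
    also have "\<dots> = (CLINT \<omega>|M. (exp (c * Y \<omega>) / m) *\<^sub>R iexp (t * Y \<omega>))"
      unfolding N_def using m by (subst integral_density) auto
    also have "\<dots> = (CLINT \<omega>|M. exp (Complex c t * Y \<omega>) / m)"
    proof (intro Bochner_Integration.integral_cong refl)
      fix \<omega>
      have "exp (Complex c t * Y \<omega>) = of_real (exp (c * Y \<omega>)) * iexp (t * Y \<omega>)"
        unfolding exp_of_real[symmetric] exp_add[symmetric] by (simp add: Complex_eq algebra_simps)
      then show "(exp (c * Y \<omega>) / m) *\<^sub>R iexp (t * Y \<omega>) = exp (Complex c t * Y \<omega>) / m"
        by (simp add: scaleR_conv_of_real)
    qed
    finally show ?thesis by (simp add: \<Phi>_def)
  qed
  have "integrable lborel (char \<mu>)" unfolding char using int\<Phi> by simp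
  from \<mu>.integrable_char_density[OF this] obtain h where h:
    "continuous_on UNIV h" "\<And>x. h x \<ge> 0"
    "\<And>x. complex_of_real (h x) = 1 / (2 * pi) * (CLINT t|lborel. iexp (- (t * x)) * char \<mu> t)"
    "\<mu> = density lborel (\<lambda>x. ennreal (h x))" by blast
  have [measurable]: "h \<in> borel_measurable borel" by (intro borel_measurable_continuous_onI h)
  define g where "g = (\<lambda>y. m * exp (- (c * y)) * h y)"
  have "density_continuous_on M Y UNIV g"
    unfolding density_continuous_on_def distributed_def
  proof (intro conjI allI)
    show "distr M lborel Y = density lborel (\<lambda>x. ennreal (g x))"
    proof (rule measure_eqI)
      fix A assume "A \<in> sets (distr M lborel Y)"
      then have [measurable]: "A \<in> sets borel" by simp
      have "emeasure (distr M lborel Y) A = (\<integral>\<^sup>+\<omega>. indicator A (Y \<omega>) \<partial>M)"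
        by (subst nn_integral_indicator[symmetric], simp, subst nn_integral_distr) auto
      \<comment> \<open>Undoing the tilt: a factor 1 is inserted, half of which is the density of
        \<open>N\<close>. The other half, \<open>m * exp (- (c * y))\<close>, ends up in
        \<open>g\<close>.\<close>
      also have "\<dots> = (\<integral>\<^sup>+\<omega>. ennreal (exp (c * Y \<omega>) / m) * (ennreal (m * exp (- (c * Y \<omega>))) * indicator A (Y \<omega>)) \<partial>M)"
      proof (rule nn_integral_cong)
        fix \<omega>
        have "ennreal (exp (c * Y \<omega>) / m) * ennreal (m * exp (- (c * Y \<omega>))) = 1"
          using m by (simp add: exp_minus flip: ennreal_mult'')
        then show "indicator A (Y \<omega>) = ennreal (exp (c * Y \<omega>) / m) * (ennreal (m * exp (- (c * Y \<omega>))) * indicator A (Y \<omega>))"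
          by (simp flip: mult.assoc)
      qed
      also have "\<dots> = (\<integral>\<^sup>+\<omega>. ennreal (m * exp (- (c * Y \<omega>))) * indicator A (Y \<omega>) \<partial>N)"
        unfolding N_def by (subst nn_integral_density) auto
      also have "\<dots> = (\<integral>\<^sup>+y. ennreal (m * exp (- (c * y))) * indicator A y \<partial>\<mu>)"
        unfolding \<mu>_def by (subst nn_integral_distr) auto
      also have "\<dots> = (\<integral>\<^sup>+y. ennreal (h y) * (ennreal (m * exp (- (c * y))) * indicator A y) \<partial>lborel)"
        unfolding h(4) by (subst nn_integral_density) auto
      also have "\<dots> = (\<integral>\<^sup>+y. ennreal (g y) * indicator A y \<partial>lborel)"
        using m h(2) by (intro nn_integral_cong) (auto simp: g_def ennreal_mult mult_ac)
      also have "\<dots> = emeasure (density lborel (\<lambda>x. ennreal (g x))) A"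
        by (subst emeasure_density) (auto simp: g_def)
      finally show "emeasure (distr M lborel Y) A = emeasure (density lborel (\<lambda>x. ennreal (g x))) A" .
    qed simp
    show "(\<lambda>x. ennreal (g x)) \<in> borel_measurable lborel" unfolding g_def by simp
    show "continuous_on UNIV g" unfolding g_def by (intro continuous_intros h)
    show "0 \<le> g y" for y using m h(2) by (simp add: g_def)
  qed simp
  moreover have "complex_of_real (g y) = 1 / (2 * pi) * (CLINT t|lborel. \<Phi> t * exp (- (Complex c t * y)))" for y
  proof -
    have "complex_of_real (g y) = of_real (m * exp (- (c * y))) * (1 / (2 * pi) * (CLINT t|lborel. iexp (- (t * y)) * char \<mu> t))"
      unfolding g_def of_real_mult h(3) by simp
    also have "\<dots> = 1 / (2 * pi) * (CLINT t|lborel. of_real (m * exp (- (c * y))) * (iexp (- (t * y)) * char \<mu> t))"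
      by (simp only: integral_mult_right_zero mult.left_commute)
    also have "(\<lambda>t. of_real (m * exp (- (c * y))) * (iexp (- (t * y)) * char \<mu> t)) = (\<lambda>t. \<Phi> t * exp (- (Complex c t * y)))"
    proof
      fix t
      have "exp (- (Complex c t * y)) = of_real (exp (- (c * y))) * iexp (- (t * y))"
        unfolding exp_of_real[symmetric] exp_add[symmetric] by (simp add: Complex_eq algebra_simps)
      then show "of_real (m * exp (- (c * y))) * (iexp (- (t * y)) * char \<mu> t) = \<Phi> t * exp (- (Complex c t * y))"
        unfolding char using m by simp
    qed
    finally show ?thesis .
  qed
  ultimately show ?thesis using that by blast
qed

section \<open>Exponential moments\<close>

context prob_space
begin

text \<open>The sign of \<open>Y \<omega>\<close> decides which end of [p, q] dominates; the sum
  covers both cases.\<close>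

lemma exp_moment_bound:
  fixes Y :: "'a \<Rightarrow> real" and s :: complex
  assumes "p \<le> Re s" "Re s \<le> q"
  shows "norm (exp (s * Y \<omega>)) \<le> exp (p * Y \<omega>) + exp (q * Y \<omega>)"
proof -
  have "Re s * Y \<omega> \<le> p * Y \<omega> \<or> Re s * Y \<omega> \<le> q * Y \<omega>"
    using assms by (cases "Y \<omega> \<ge> 0") (auto intro: mult_right_mono mult_right_mono_neg)
  then have "exp (Re s * Y \<omega>) \<le> exp (p * Y \<omega>) + exp (q * Y \<omega>)"
    by (smt (verit) exp_ge_zero exp_le_cancel_iff)
  then show ?thesis by simp
qed

lemma exp_moment_integrable:
  fixes Y :: "'a \<Rightarrow> real" and s :: complex
  assumes [measurable]: "Y \<in> borel_measurable M"
    and "integrable M (\<lambda>\<omega>. exp (p * Y \<omega>))" "integrable M (\<lambda>\<omega>. exp (q * Y \<omega>))"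
    and "p \<le> Re s" "Re s \<le> q"
  shows "integrable M (\<lambda>\<omega>. exp (s * Y \<omega>))"
proof (rule Bochner_Integration.integrable_bound)
  show "integrable M (\<lambda>\<omega>. exp (p * Y \<omega>) + exp (q * Y \<omega>))" using assms by simp
  show "AE \<omega> in M. norm (exp (s * Y \<omega>)) \<le> norm (exp (p * Y \<omega>) + exp (q * Y \<omega>))"
    using exp_moment_bound[OF assms(4,5), of Y] by (auto intro!: AE_I2)
qed simp

lemma exp_moment_integrable_real:
  fixes Y :: "'a \<Rightarrow> real"
  assumes "Y \<in> borel_measurable M"
    and "integrable M (\<lambda>\<omega>. exp (p * Y \<omega>))" "integrable M (\<lambda>\<omega>. exp (q * Y \<omega>))"
    and "p \<le> x" "x \<le> q"
  shows "integrable M (\<lambda>\<omega>. exp (x * Y \<omega>))"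
  using integrable_norm[OF exp_moment_integrable[OF assms(1-3), of "of_real x"]] assms by simp

lemma exp_moment_norm_le:
  fixes Y :: "'a \<Rightarrow> real" and s :: complex
  assumes "Y \<in> borel_measurable M"
    and "integrable M (\<lambda>\<omega>. exp (p * Y \<omega>))" "integrable M (\<lambda>\<omega>. exp (q * Y \<omega>))"
    and "p \<le> Re s" "Re s \<le> q"
  shows "norm (CLINT \<omega>|M. exp (s * Y \<omega>)) \<le> expectation (\<lambda>\<omega>. exp (p * Y \<omega>)) + expectation (\<lambda>\<omega>. exp (q * Y \<omega>))"
proof -
  have "norm (CLINT \<omega>|M. exp (s * Y \<omega>)) \<le> expectation (\<lambda>\<omega>. exp (p * Y \<omega>) + exp (q * Y \<omega>))"
    using assms exp_moment_integrable[OF assms] exp_moment_bound[OF assms(4,5), of Y] exp_moment_integrable_real[OF assms]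
    by (intro order_trans[OF integral_norm_bound integral_mono]) auto
  then show ?thesis using assms by simp
qed

text \<open>Around \<open>s0\<close> the factor \<open>exp ((s - s0) * Y)\<close> is expanded in
  powers of \<open>s - s0\<close> and integrated term by term. The norms of the terms sum to
  \<open>exp (r * \<bar>Y\<bar>) * exp (Re s0 * Y)\<close>, which is controlled by the exponential
  moments at \<open>Re s0 - r\<close> and \<open>Re s0 + r\<close>; both points stay in the strip
  since \<open>r < d\<close>.\<close>

lemma exp_moment_holomorphic:
  fixes Y :: "'a \<Rightarrow> real"
  assumes Y[measurable]: "Y \<in> borel_measurable M"
    and int: "integrable M (\<lambda>\<omega>. exp (p * Y \<omega>))" "integrable M (\<lambda>\<omega>. exp (q * Y \<omega>))"
  shows "(\<lambda>s. CLINT \<omega>|M. exp (s * Y \<omega>)) holomorphic_on {s. p < Re s \<and> Re s < q}"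
proof -
  have "(\<lambda>s. CLINT \<omega>|M. exp (s * Y \<omega>)) analytic_on {s. p < Re s \<and> Re s < q}"
    unfolding analytic_on_def
  proof (rule ballI)
    fix s0 assume s0: "s0 \<in> {s. p < Re s \<and> Re s < q}"
    define d where "d = min (Re s0 - p) (q - Re s0)"
    have d: "d > 0" using s0 by (auto simp: d_def)
    have "(\<lambda>s. CLINT \<omega>|M. exp (s * Y \<omega>)) holomorphic_on ball s0 d"
    proof (rule power_series_holomorphic[where a = "\<lambda>n. (CLINT \<omega>|M. of_real (Y \<omega>) ^ n * exp (s0 * Y \<omega>)) / fact n"])
      fix s assume s: "s \<in> ball s0 d"
      define r where "r = norm (s - s0)"
      have r: "0 \<le> r" "r < d" using s by (auto simp: r_def dist_norm norm_minus_commute)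
      define f where "f = (\<lambda>n \<omega>. ((s - s0) * Y \<omega>) ^ n / fact n * exp (s0 * Y \<omega>))"
      define W where "W = (\<lambda>\<omega>. exp ((Re s0 - r) * Y \<omega>) + exp ((Re s0 + r) * Y \<omega>))"
      have W: "integrable M W" unfolding W_def
        using r d by (intro Bochner_Integration.integrable_add exp_moment_integrable_real[OF Y int]) (auto simp: d_def)
      have nf: "norm (f n \<omega>) = (r * \<bar>Y \<omega>\<bar>) ^ n / fact n * exp (Re s0 * Y \<omega>)" for n \<omega>
        by (simp add: f_def r_def norm_mult norm_power norm_divide)
      have es: "(\<lambda>n. (r * \<bar>Y \<omega>\<bar>) ^ n / fact n * exp (Re s0 * Y \<omega>)) sums (exp (r * \<bar>Y \<omega>\<bar>) * exp (Re s0 * Y \<omega>))" for \<omega>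
        using sums_mult2[OF exp_converges[of "r * \<bar>Y \<omega>\<bar>"], of "exp (Re s0 * Y \<omega>)"]
        by (simp add: divide_inverse mult.commute)
      have le: "exp (r * \<bar>Y \<omega>\<bar>) * exp (Re s0 * Y \<omega>) \<le> W \<omega>" for \<omega>
        by (cases "Y \<omega> \<ge> 0") (auto simp: W_def algebra_simps simp flip: exp_add)
      \<comment> \<open>This bound, uniform in \<open>N\<close>, provides the integrability of each
        term as well as the summability of the integrated norms.\<close>
      have part: "(\<Sum>n<N. norm (f n \<omega>)) \<le> W \<omega>" for N \<omega>
      proof -
        have "(\<Sum>n<N. norm (f n \<omega>)) \<le> (\<Sum>n. norm (f n \<omega>))"
          unfolding nf by (rule sum_le_suminf[OF sums_summable[OF es]]) (use r in auto)
        also have "\<dots> \<le> W \<omega>" unfolding nf sums_unique[OF es, symmetric] by (rule le)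
        finally show ?thesis .
      qed
      have intf: "integrable M (f n)" for n
      proof (rule Bochner_Integration.integrable_bound[OF W])
        have "norm (f n \<omega>) \<le> W \<omega>" for \<omega>
          using part[of \<omega> "Suc n"] sum_nonneg[of "{..<n}" "\<lambda>n. norm (f n \<omega>)"] by simp
        then show "AE \<omega> in M. norm (f n \<omega>) \<le> norm (W \<omega>)"
          by (auto intro!: AE_I2 intro: order_trans[OF _ abs_ge_self])
      qed (simp add: f_def)
      have "(\<lambda>n. CLINT \<omega>|M. f n \<omega>) sums (CLINT \<omega>|M. (\<Sum>n. f n \<omega>))"
      proof (rule sums_integral[OF intf])
        show "AE \<omega> in M. summable (\<lambda>n. norm (f n \<omega>))"
          unfolding nf by (intro AE_I2 sums_summable[OF es])
        show "summable (\<lambda>n. LINT \<omega>|M. norm (f n \<omega>))"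
        proof (rule bounded_imp_summable)
          fix N
          have "(\<Sum>n\<le>N. LINT \<omega>|M. norm (f n \<omega>)) = (LINT \<omega>|M. (\<Sum>n\<le>N. norm (f n \<omega>)))"
            using intf by (intro Bochner_Integration.integral_sum[symmetric]) auto
          also have "\<dots> \<le> (LINT \<omega>|M. W \<omega>)"
            using intf W part[of _ "Suc N"] by (intro integral_mono) (auto simp: lessThan_Suc_atMost)
          finally show "(\<Sum>n\<le>N. LINT \<omega>|M. norm (f n \<omega>)) \<le> (LINT \<omega>|M. W \<omega>)" .
        qed (auto intro!: Bochner_Integration.integral_nonneg)
      qed
      moreover have "(CLINT \<omega>|M. f n \<omega>) = (CLINT \<omega>|M. of_real (Y \<omega>) ^ n * exp (s0 * Y \<omega>)) / fact n * (s - s0) ^ n" for n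
      proof -
        have "f n = (\<lambda>\<omega>. (s - s0) ^ n / fact n * (of_real (Y \<omega>) ^ n * exp (s0 * Y \<omega>)))"
          by (auto simp: f_def power_mult_distrib)
        then show ?thesis by (simp add: mult_ac)
      qed
      moreover have "(\<Sum>n. f n \<omega>) = exp (s * Y \<omega>)" for \<omega>
      proof -
        have "(\<lambda>n. f n \<omega>) sums (exp ((s - s0) * Y \<omega>) * exp (s0 * Y \<omega>))"
          unfolding f_def using sums_mult2[OF exp_converges[of "(s - s0) * Y \<omega>"]]
          by (simp add: scaleR_conv_of_real field_simps)
        then show ?thesis by (simp add: sums_iff algebra_simps flip: exp_add)
      qed
      ultimately show "(\<lambda>n. (CLINT \<omega>|M. of_real (Y \<omega>) ^ n * exp (s0 * Y \<omega>)) / fact n * (s - s0) ^ n)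
          sums (CLINT \<omega>|M. exp (s * Y \<omega>))" by simp
    qed
    then show "\<exists>\<epsilon>>0. (\<lambda>s. CLINT \<omega>|M. exp (s * Y \<omega>)) holomorphic_on ball s0 \<epsilon>" using d by blast
  qed
  then show ?thesis by (rule analytic_imp_holomorphic)
qed

end

section \<open>Meromorphic functions of Gamma type\<close>

definition gamma_quotient where
  "gamma_quotient J K C D a b a' b' = (\<lambda>s. of_real C * of_real D powr s *
       (\<Prod>j=1..J. Gamma (of_real (a j) * s + of_real (b j))) /
       (\<Prod>k=1..K. Gamma (of_real (a' k) * s + of_real (b' k))) :: complex)"

text \<open>Poles of the Gamma factors in the denominator are included although they do not produce
  poles: with the value 0 of Gamma there, the raw quotient is a division by zero and may differ from
  its limit.\<close>

definition gamma_singularities :: "nat \<Rightarrow> nat \<Rightarrow> (nat \<Rightarrow> real) \<Rightarrow> (nat \<Rightarrow> real) \<Rightarrow> (nat \<Rightarrow> real) \<Rightarrow> (nat \<Rightarrow> real) \<Rightarrow> complex set" where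
  "gamma_singularities J K a b a' b' =
     {s. \<exists>j\<in>{1..J}. of_real (a j) * s + of_real (b j) \<in> \<int>\<^sub>\<le>\<^sub>0} \<union>
     {s. \<exists>k\<in>{1..K}. of_real (a' k) * s + of_real (b' k) \<in> \<int>\<^sub>\<le>\<^sub>0}"

lemma finite_affine_nonpos_Ints:
  fixes a b :: real
  assumes "a \<noteq> 0"
  shows "finite {s. x1 \<le> Re s \<and> Re s \<le> x2 \<and> of_real a * s + of_real b \<in> \<int>\<^sub>\<le>\<^sub>0}"
proof (rule finite_subset)
  define B where "B = \<bar>a\<bar> * max \<bar>x1\<bar> \<bar>x2\<bar> + \<bar>b\<bar>"
  show "finite ((\<lambda>n::int. (of_int n - of_real b) / of_real a :: complex) ` {\<lfloor>-B\<rfloor>..\<lceil>B\<rceil>})" by simp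
  show "{s. x1 \<le> Re s \<and> Re s \<le> x2 \<and> of_real a * s + of_real b \<in> \<int>\<^sub>\<le>\<^sub>0} \<subseteq>
    (\<lambda>n::int. (of_int n - of_real b) / of_real a) ` {\<lfloor>-B\<rfloor>..\<lceil>B\<rceil>}"
  proof safe
    fix s assume s: "x1 \<le> Re s" "Re s \<le> x2" "of_real a * s + of_real b \<in> \<int>\<^sub>\<le>\<^sub>0"
    then obtain n :: int where n: "of_real a * s + of_real b = of_int n"
      by (elim nonpos_Ints_cases) auto
    then have "Re (of_real a * s + of_real b) = of_int n" by simp
    then have "of_int n = a * Re s + b" by simp
    moreover have "\<bar>a * Re s\<bar> \<le> \<bar>a\<bar> * max \<bar>x1\<bar> \<bar>x2\<bar>"
      unfolding abs_mult using s by (intro mult_left_mono) auto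
    ultimately have "-B \<le> of_int n" "of_int n \<le> B" unfolding B_def by linarith+
    then have "n \<in> {\<lfloor>-B\<rfloor>..\<lceil>B\<rceil>}" by (auto simp: floor_le_iff le_ceiling_iff)
    moreover have "s = (of_int n - of_real b) / of_real a" using n assms by (simp add: field_simps)
    ultimately show "s \<in> (\<lambda>n::int. (of_int n - of_real b) / of_real a) ` {\<lfloor>-B\<rfloor>..\<lceil>B\<rceil>}" by blast
  qed
qed

context
  fixes J K :: nat and C D :: real and a b a' b' :: "nat \<Rightarrow> real"
  assumes D: "D > 0" and a: "\<forall>j\<in>{1..J}. a j \<noteq> 0" and a': "\<forall>k\<in>{1..K}. a' k \<noteq> 0"
begin

private abbreviation (input) "R \<equiv> gamma_quotient J K C D a b a' b'"
private abbreviation (input) "F \<equiv> gamma_type_fun J K C D a b a' b'"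
private abbreviation (input) "Z \<equiv> gamma_singularities J K a b a' b'"

lemma gamma_type_fun_eq: "F = remove_sings R"
  unfolding gamma_type_fun_def gamma_quotient_def ..

lemma gamma_singularities_real: 
  assumes "s \<in> Z" shows "Im s = 0"
proof -
  have *: "Im s = 0" if "of_real c * s + of_real d \<in> \<int>\<^sub>\<le>\<^sub>0" "c \<noteq> 0" for c d :: real
  proof -
    have "Im (of_real c * s + of_real d) = 0" using that(1) by (elim nonpos_Ints_cases) simp
    then show ?thesis using that(2) by simp
  qed
  from assms consider j where "j \<in> {1..J}" "of_real (a j) * s + of_real (b j) \<in> \<int>\<^sub>\<le>\<^sub>0"
    | k where "k \<in> {1..K}" "of_real (a' k) * s + of_real (b' k) \<in> \<int>\<^sub>\<le>\<^sub>0"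
    unfolding gamma_singularities_def by blast
  then show ?thesis using * a a' by cases metis+
qed

lemma finite_gamma_singularities: "finite (Z \<inter> {s. x1 \<le> Re s \<and> Re s \<le> x2})"
proof -
  have "Z \<inter> {s. x1 \<le> Re s \<and> Re s \<le> x2} =
    (\<Union>j\<in>{1..J}. {s. x1 \<le> Re s \<and> Re s \<le> x2 \<and> of_real (a j) * s + of_real (b j) \<in> \<int>\<^sub>\<le>\<^sub>0}) \<union>
    (\<Union>k\<in>{1..K}. {s. x1 \<le> Re s \<and> Re s \<le> x2 \<and> of_real (a' k) * s + of_real (b' k) \<in> \<int>\<^sub>\<le>\<^sub>0})"
    unfolding gamma_singularities_def by blast
  also have "finite \<dots>"
    using a a' by (intro finite_UnI finite_UN_I finite_affine_nonpos_Ints) auto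
  finally show ?thesis .
qed

lemma prod_rGamma: "(\<Prod>i\<in>A. rGamma (f i)) = inverse (\<Prod>i\<in>A. Gamma (f i :: complex))"
  using prod_inversef[of "\<lambda>i. Gamma (f i)" A] by (simp add: rGamma_inverse_Gamma o_def)

lemma gamma_quotient_analytic: "s \<notin> Z \<Longrightarrow> R analytic_on {s}"
  unfolding gamma_quotient_def gamma_singularities_def
  using D by (intro analytic_intros) (auto simp: Gamma_eq_zero_iff)

text \<open>\<open>Gamma = inverse rGamma\<close> holds even at the poles, where both sides are 0,
  and \<open>rGamma\<close> is entire. So meromorphy on the whole plane is inherited from entire
  functions.\<close>

lemma gamma_quotient_meromorphic: "R meromorphic_on UNIV"
proof -
  have "R = (\<lambda>s. of_real C * exp (s * of_real (ln D)) *
       (\<Prod>j=1..J. inverse (rGamma (of_real (a j) * s + of_real (b j)))) /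
       (\<Prod>k=1..K. inverse (rGamma (of_real (a' k) * s + of_real (b' k)))))"
    unfolding gamma_quotient_def using D by (auto simp: powr_def Ln_of_real rGamma_inverse_Gamma)
  moreover have "\<dots> meromorphic_on UNIV"
  proof -
    have 1: "(\<lambda>s. exp (s * of_real (ln D))) meromorphic_on UNIV"
      by (intro analytic_on_imp_meromorphic_on analytic_intros)
    have 2: "(\<lambda>s. inverse (rGamma (of_real c * s + of_real d))) meromorphic_on UNIV" for c d :: real
      by (intro meromorphic_on_inverse analytic_on_imp_meromorphic_on analytic_intros)
    show ?thesis
      by (intro meromorphic_on_divide meromorphic_on_mult meromorphic_on_prod meromorphic_on_const 1 2)
  qed
  ultimately show ?thesis by simp
qed

lemma gamma_type_fun_nicely_meromorphic: "F nicely_meromorphic_on UNIV"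
  unfolding gamma_type_fun_eq by (rule remove_sings_nicely_meromorphic[OF gamma_quotient_meromorphic])

lemma gamma_type_fun_eq_quotient: "s \<notin> Z \<Longrightarrow> F s = R s"
  unfolding gamma_type_fun_eq by (rule remove_sings_at_analytic[OF gamma_quotient_analytic])

lemma gamma_type_fun_poles: 
  assumes "is_pole F s" shows "s \<in> Z"
proof (rule ccontr)
  assume "s \<notin> Z"
  then have "F analytic_on {s}"
    unfolding gamma_type_fun_eq by (intro remove_sings_analytic_on gamma_quotient_analytic)
  then show False using assms analytic_at not_is_pole_holomorphic by blast
qed

lemma finite_gamma_type_fun_poles: "finite {s. is_pole F s \<and> x1 \<le> Re s \<and> Re s \<le> x2}"
  by (rule finite_subset[OF _ finite_gamma_singularities[of x1 x2]]) (auto dest: gamma_type_fun_poles)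

text \<open>Each Gamma factor contributes its slope in modulus times \<open>- pi / 2\<close> in the
  numerator and \<open>pi / 2\<close> in the denominator; the sum is \<open>gamma_exponent\<close>
  up to the factor \<open>- (pi / 2)\<close>.\<close>

lemma gamma_type_fun_vertical_growth:
  "vertical_growth x1 x2 F (- (pi / 2) * gamma_exponent J K a a')"
proof (rule vertical_growth_cong)
  show "R s = F s" if "Im s \<noteq> 0" for s
  proof -
    have "s \<notin> Z" using that gamma_singularities_real by blast
    then show ?thesis using gamma_type_fun_eq_quotient by simp
  qed
  have "vertical_growth x1 x2 (\<lambda>s. of_real C * of_real D powr s *
       (\<Prod>j=1..J. Gamma (of_real (a j) * s + of_real (b j))) *
       (\<Prod>k=1..K. rGamma (of_real (a' k) * s + of_real (b' k))))
     (0 + 0 + (\<Sum>j=1..J. \<bar>a j\<bar> * (- pi / 2)) + (\<Sum>k=1..K. \<bar>a' k\<bar> * (pi / 2)))"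
    using a a' D by (intro vertical_growth_mult vertical_growth_const vertical_growth_powr vertical_growth_prod
      vertical_growth_affine vertical_growth_Gamma vertical_growth_rGamma) auto
  also have "(0 + 0 + (\<Sum>j=1..J. \<bar>a j\<bar> * (- pi / 2)) + (\<Sum>k=1..K. \<bar>a' k\<bar> * (pi / 2))) =
     - (pi / 2) * gamma_exponent J K a a'"
    unfolding gamma_exponent_def sum_distrib_right[symmetric] by (simp add: field_simps)
  finally show "vertical_growth x1 x2 (\<lambda>s. R s) (- (pi / 2) * gamma_exponent J K a a')"
    unfolding gamma_quotient_def prod_rGamma divide_inverse .
qed

text \<open>
  Clearing denominators turns \<open>\<Phi> = F\<close> into an identity between entire multiples of \<open>\<Phi>\<close> and an entire function.
\<close>

lemma gamma_type_fun_continuation: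
  assumes hol: "\<Phi> holomorphic_on {s. p < Re s \<and> Re s < q}"
    and \<alpha>\<beta>: "p \<le> \<alpha>" "\<alpha> < \<beta>" "\<beta> \<le> q"
    and eq: "\<And>x. \<alpha> < x \<Longrightarrow> x < \<beta> \<Longrightarrow> \<Phi> (of_real x) = F (of_real x)"
    and s: "p < Re s" "Re s < q"
  shows "F s = \<Phi> s"
proof -
  let ?S = "{s. p < Re s \<and> Re s < q}"
  \<comment> \<open>Both functions are entire: the Gamma factors of the denominator move into
    \<open>G\<close> as reciprocals, those of the numerator into \<open>H\<close>, so that
    \<open>R = G / H\<close>.\<close>
  define G where "G = (\<lambda>s. of_real C * of_real D powr s * (\<Prod>k=1..K. rGamma (of_real (a' k) * s + of_real (b' k))) :: complex)"
  define H where "H = (\<lambda>s. \<Prod>j=1..J. rGamma (of_real (a j) * s + of_real (b j)) :: complex)"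
  have "?S = {s. Re s > p} \<inter> {s. Re s < q}" by auto
  then have S: "open ?S" "connected ?S"
    by (simp_all add: open_Int open_halfspace_Re_gt open_halfspace_Re_lt convex_connected convex_Int
          convex_halfspace_Re_gt convex_halfspace_Re_lt)
  have H0: "H s \<noteq> 0" if "s \<notin> Z" for s
    using that unfolding H_def gamma_singularities_def by (auto simp: rGamma_eq_zero_iff)
  have RGH: "R s = G s / H s" for s
    unfolding gamma_quotient_def G_def H_def
    unfolding prod_rGamma divide_inverse by (simp add: mult_ac)
  have GH: "\<Phi> s * H s - G s = 0" if "s \<in> ?S" for s
  proof (rule analytic_continuation[where f = "\<lambda>s. \<Phi> s * H s - G s" and w = s and S = ?S])
    show "(\<lambda>s. \<Phi> s * H s - G s) holomorphic_on ?S"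
      unfolding G_def H_def using D by (intro holomorphic_intros hol) auto
    \<comment> \<open>On the segment, \<open>F\<close> is known to equal \<open>R\<close>, and
      \<open>H\<close> to be nonzero, only off \<open>Z\<close>. Only finitely many points are lost,
      so the midpoint remains a limit point and the identity theorem applies.\<close>
    let ?U = "of_real ` {\<alpha><..<\<beta>} - Z"
    show "?U \<subseteq> ?S" using \<alpha>\<beta> by auto
    define x where "x = (\<alpha> + \<beta>) / 2"
    show "of_real x \<in> ?S" using \<alpha>\<beta> by (auto simp: x_def)
    have "x islimpt {\<alpha><..<\<beta>}" 
      using \<alpha>\<beta> by (intro interior_limit_point) (simp add: x_def interior_open)
    then have "complex_of_real x islimpt of_real ` {\<alpha><..<\<beta>}"
      unfolding islimpt_approachable by (auto simp: dist_norm simp flip: of_real_diff)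
    then have "of_real x islimpt (of_real ` {\<alpha><..<\<beta>} \<inter> Z) \<union> ?U"
      by (rule islimpt_subset) auto
    moreover have "finite (of_real ` {\<alpha><..<\<beta>} \<inter> Z)"
      by (rule finite_subset[OF _ finite_gamma_singularities[of \<alpha> \<beta>]]) auto
    ultimately show "of_real x islimpt ?U" by (simp add: islimpt_Un_finite)
    show "\<Phi> s * H s - G s = 0" if "s \<in> ?U" for s
      using that eq gamma_type_fun_eq_quotient[of s] H0[of s] RGH[of s] by auto
  qed (use S that in auto)
  \<comment> \<open>Since singularities are isolated, \<open>R\<close> agrees with
    \<open>\<Phi>\<close> on a punctured neighbourhood of \<open>s\<close> even if \<open>s\<close>
    is in \<open>Z\<close>; \<open>remove_sings\<close> then picks the limit
    \<open>\<Phi> s\<close>.\<close>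
  have ev: "\<forall>\<^sub>F w in at s. w \<notin> Z"
  proof -
    have "\<not> s islimpt (Z \<inter> {w. Re s - 1 \<le> Re w \<and> Re w \<le> Re s + 1})"
      by (intro islimpt_finite finite_gamma_singularities)
    then have "\<forall>\<^sub>F w in at s. w \<notin> Z \<inter> {w. Re s - 1 \<le> Re w \<and> Re w \<le> Re s + 1}"
      by (simp add: islimpt_iff_eventually)
    moreover have "\<forall>\<^sub>F w in at s. w \<in> ball s 1" by (intro eventually_at_in_open') auto
    ultimately show ?thesis
    proof eventually_elim
      case (elim w)
      then have "\<bar>Re (s - w)\<bar> < 1" using abs_Re_le_cmod[of "s - w"] by (auto simp: dist_norm)
      then show ?case using elim by auto
    qed
  qed
  have "\<Phi> \<midarrow>s\<rightarrow> \<Phi> s"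
    using holomorphic_on_imp_continuous_on[OF hol] continuous_on_eq_continuous_at[OF S(1), of \<Phi>] s
    by (auto simp: isCont_def)
  moreover have "\<forall>\<^sub>F w in at s. \<Phi> w = R w"
  proof -
    have "\<forall>\<^sub>F w in at s. w \<in> ?S" using S(1) s by (intro eventually_at_in_open') auto
    with ev show ?thesis
    proof eventually_elim
      case (elim w)
      then have "\<Phi> w * H w = G w" "H w \<noteq> 0" using H0 GH[of w] by auto
      then show ?case unfolding RGH by (simp add: field_simps)
    qed
  qed
  ultimately have "R \<midarrow>s\<rightarrow> \<Phi> s" by (rule Lim_transform_eventually)
  then show ?thesis unfolding gamma_type_fun_eq by (rule remove_sings_eqI)
qed

text \<open>Every point of the closed interval, endpoints included, is approached by real points of
  the open strip, where the bound on \<open>F\<close> contradicts blow-up. The endpoints matter: 0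
  can be one of them.\<close>

lemma gamma_type_fun_no_pole_closed_interval:
  assumes "p < q" "p \<le> x" "x \<le> q"
    and bd: "\<And>s. p < Re s \<Longrightarrow> Re s < q \<Longrightarrow> norm (F s) \<le> B"
  shows "\<not> is_pole F (of_real x)"
proof
  assume "is_pole F (of_real x)"
  then have "\<forall>\<^sub>F s in at (of_real x). norm (F s) > B"
    unfolding is_pole_def filterlim_at_infinity_conv_norm_at_top filterlim_at_top_dense by blast
  then obtain d where d: "d > 0" "\<And>s. s \<noteq> of_real x \<Longrightarrow> dist s (of_real x) < d \<Longrightarrow> norm (F s) > B"
    unfolding eventually_at by auto
  have "\<exists>y. p < y \<and> y < q \<and> y \<noteq> x \<and> \<bar>y - x\<bar> < d"
  proof (cases "x < q")
    case True
    define e where "e = min ((q - x) / 2) (d / 2)"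
    have "0 < e" "e < d" "e < q - x" using True d by (auto simp: e_def min_def field_simps)
    then show ?thesis using assms by (intro exI[of _ "x + e"]) auto
  next
    case False
    define e where "e = min ((q - p) / 2) (d / 2)"
    have "0 < e" "e < d" "e < q - p" using assms d by (auto simp: e_def min_def field_simps)
    then show ?thesis using assms False by (intro exI[of _ "x - e"]) auto
  qed
  then obtain y where y: "p < y" "y < q" "y \<noteq> x" "\<bar>y - x\<bar> < d" by blast
  have "norm (F (of_real y)) > B" using y by (intro d) (auto simp: dist_norm simp flip: of_real_diff)
  with bd[of "of_real y"] y show False by simp
qed

end

section \<open>Residues and contour shift\<close>

text \<open>The residue is the coefficient of index -1 in the product of the Laurent series of
  \<open>f\<close> with the power series of \<open>exp (c * (z + x))\<close>. With
  \<open>c = - y\<close> its terms are those of the expansion.\<close>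

lemma residue_times_exp:
  fixes c :: complex
  assumes L: "(\<lambda>x. f (z + x)) has_laurent_expansion L" and pole: "is_pole f z"
  shows "residue (\<lambda>s. f s * exp (c * s)) z =
    exp (c * z) * (\<Sum>l<pole_order f z. singular_coeff f z (l + 1) / fact l * c ^ l)"
proof -
  define \<nu> where "\<nu> = pole_order f z"
  have sd: "fls_subdegree L < 0" using has_laurent_expansion_imp_is_pole_iff[OF L] pole by simp
  then have "L \<noteq> 0" by auto
  then have "zorder f z = fls_subdegree L" by (rule has_laurent_expansion_zorder[OF L])
  then have sd': "fls_subdegree L = - int \<nu>" "\<nu> > 0" using sd by (auto simp: \<nu>_def pole_order_def)
  have sc: "singular_coeff f z l = fls_nth L (- int l)" for l
    unfolding singular_coeff_def laurent_expansion_eqI[OF L] ..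
  have "(\<lambda>x. f (z + x) * (exp (c * z) * exp (c * x))) has_laurent_expansion
      L * (fls_const (exp (c * z)) * fps_to_fls (fps_exp c))"
    by (intro has_laurent_expansion_mult has_laurent_expansion_const L has_laurent_expansion_fps has_fps_expansion_exp)
  then have "(\<lambda>x. f (z + x) * exp (c * (z + x))) has_laurent_expansion
      fls_const (exp (c * z)) * (L * fps_to_fls (fps_exp c))"
    by (simp add: distrib_left exp_add mult_ac)
  from has_laurent_expansion_residue[where f = "\<lambda>s. f s * exp (c * s)", OF this]
  have "residue (\<lambda>s. f s * exp (c * s)) z = exp (c * z) * fls_nth (L * fps_to_fls (fps_exp c)) (- 1)"
    by simp
  also have "fls_nth (L * fps_to_fls (fps_exp c)) (- 1) =
      (\<Sum>i = - int \<nu>..- 1. fls_nth L i * fls_nth (fps_to_fls (fps_exp c)) (- 1 - i))"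
    unfolding fls_times_nth(2) sd' by (simp add: fls_subdegree_fls_to_fps)
  \<comment> \<open>Substitution \<open>i = - (l + 1)\<close>: the pole of order
    \<open>\<nu>\<close> leaves exactly the exponents \<open>l < \<nu>\<close> of the exponential
    series.\<close>
  also have "\<dots> = (\<Sum>l<\<nu>. fls_nth L (- int (l + 1)) * fls_nth (fps_to_fls (fps_exp c)) (int l))"
    by (rule sum.reindex_bij_witness[where i = "\<lambda>l. - int (l + 1)" and j = "\<lambda>i. nat (- 1 - i)"]) auto
  also have "\<dots> = (\<Sum>l<\<nu>. singular_coeff f z (l + 1) / fact l * c ^ l)"
    by (intro sum.cong) (auto simp: sc)
  finally show ?thesis unfolding \<nu>_def .
qed

lemma integrable_inverse_1_plus_square_lborel: "integrable lborel (\<lambda>x::real. inverse (1 + x\<^sup>2))"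
  using integrable_inverse_1_plus_square by (simp add: set_integrable_def einterval_iff indicator_def)

text \<open>Everything that inversion and contour shift require of \<open>F\<close>; Gamma no longer
  occurs. For functions of Gamma type, \<open>\<theta>\<close> is \<open>pi / 2\<close> times the
  exponent \<gamma>.\<close>

locale vertically_decaying =
  fixes F :: "complex \<Rightarrow> complex" and \<theta> :: real
  assumes mero: "F nicely_meromorphic_on UNIV"
    and real_poles: "\<And>s. is_pole F s \<Longrightarrow> Im s = 0"
    and fin_poles: "\<And>x1 x2. finite {s. is_pole F s \<and> x1 \<le> Re s \<and> Re s \<le> x2}"
    and growth: "\<And>x1 x2. vertical_growth x1 x2 F (- \<theta>)" and \<theta>: "\<theta> > 0"
begin

lemma holomorphic_off_poles:
  assumes "\<And>s. s \<in> A \<Longrightarrow> \<not> is_pole F s" shows "F holomorphic_on A"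
proof (rule analytic_imp_holomorphic)
  show "F analytic_on A"
    using assms nicely_meromorphic_on_imp_analytic_at[OF mero]
    by (subst analytic_on_analytic_at) auto
qed

lemma vertical_line_continuous:
  assumes "\<not> is_pole F (of_real u)"
  shows "continuous_on A (\<lambda>t. F (Complex u t))"
proof -
  have "\<not> is_pole F s" if "Re s = u" for s
    using real_poles[of s] assms that by (metis complex_eq_iff complex_of_real_def complex.sel)
  then have "continuous_on {s. Re s = u} F"
    by (intro holomorphic_on_imp_continuous_on holomorphic_off_poles) auto
  then have "continuous_on A (F \<circ> Complex u)"
    by (intro continuous_on_compose continuous_on_Complex continuous_intros) (auto elim: continuous_on_subset)
  then show ?thesis by (simp add: o_def)
qed

text \<open>Half of the decay rate is spent on \<open>\<epsilon>\<close>; the remaining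
  \<open>exp (- \<theta> / 2 * \<bar>t\<bar>)\<close> is compared with
  \<open>1 / (1 + t\<^sup>2)\<close> for \<open>\<bar>t\<bar> > 1\<close>, and compactness handles
  the middle piece.\<close>

lemma vertical_line_integrable:
  assumes "\<not> is_pole F (of_real u)"
  shows "integrable lborel (\<lambda>t. F (Complex u t))"
proof -
  note cont = vertical_line_continuous[OF assms]
  obtain K where K: "K \<ge> 0" "\<And>s. u \<le> Re s \<Longrightarrow> Re s \<le> u \<Longrightarrow> 1 \<le> \<bar>Im s\<bar> \<Longrightarrow>
      norm (F s) \<le> K * exp ((- \<theta> + \<theta> / 2) * \<bar>Im s\<bar>)"
    using vertical_growthE[OF growth, of 1 "\<theta> / 2" u u] \<theta> by auto
  have "bounded ((\<lambda>t. F (Complex u t)) ` {-1..1})"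
    by (intro compact_imp_bounded compact_continuous_image cont) auto
  then obtain B where B: "B > 0" "\<And>t. t \<in> {-1..1} \<Longrightarrow> norm (F (Complex u t)) \<le> B"
    unfolding bounded_pos by auto
  \<comment> \<open>Chosen so that
    \<open>m * (1 + t\<^sup>2) \<le> 1 + x + x\<^sup>2 / 2 \<le> exp x\<close> for
    \<open>x = \<theta> / 2 * \<bar>t\<bar>\<close>.\<close>
  define m where "m = min 1 (\<theta>\<^sup>2 / 8)"
  have m: "m > 0" using \<theta> by (simp add: m_def)
  show ?thesis
  proof (rule Bochner_Integration.integrable_bound)
    show "integrable lborel (\<lambda>t. (2 * B + K / m) * inverse (1 + t\<^sup>2))"
      by (intro integrable_mult_right integrable_inverse_1_plus_square_lborel)
    show "(\<lambda>t. F (Complex u t)) \<in> borel_measurable lborel"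
      using borel_measurable_continuous_onI[OF cont] by simp
    show "AE t in lborel. norm (F (Complex u t)) \<le> norm ((2 * B + K / m) * inverse (1 + t\<^sup>2))"
    proof (rule AE_I2)
      fix t :: real
      have pos: "1 + t\<^sup>2 > 0" by (simp add: add_pos_nonneg)
      have "norm (F (Complex u t)) \<le> (2 * B + K / m) * inverse (1 + t\<^sup>2)"
      proof (cases "\<bar>t\<bar> \<le> 1")
        case True
        then have "t\<^sup>2 \<le> 1" by (simp add: abs_square_le_1)
        then have "B * (1 + t\<^sup>2) \<le> B * 2" using B(1) by (intro mult_left_mono) auto
        then have "B \<le> 2 * B * inverse (1 + t\<^sup>2)" using pos by (simp add: field_simps)
        also have "\<dots> \<le> (2 * B + K / m) * inverse (1 + t\<^sup>2)"
          using K m pos by (intro mult_right_mono) auto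
        finally show ?thesis using B(2)[of t] True by (auto simp: abs_le_iff)
      next
        case False
        define x where "x = \<theta> / 2 * \<bar>t\<bar>"
        have "0 \<le> x" using \<theta> by (simp add: x_def)
        have "1 + x + x\<^sup>2 / 2 \<le> exp x" by (rule exp_lower_Taylor_quadratic[OF \<open>0 \<le> x\<close>])
        moreover have "x\<^sup>2 / 2 = \<theta>\<^sup>2 / 8 * t\<^sup>2" by (simp add: x_def power_mult_distrib power_divide)
        moreover have "m * t\<^sup>2 \<le> \<theta>\<^sup>2 / 8 * t\<^sup>2" "m \<le> 1"
          by (intro mult_right_mono) (auto simp: m_def)
        ultimately have "m * (1 + t\<^sup>2) \<le> exp x" using \<open>0 \<le> x\<close> by (simp add: algebra_simps)
        then have e: "exp (- x) \<le> inverse (m * (1 + t\<^sup>2))"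
          unfolding exp_minus using m pos by (intro le_imp_inverse_le) auto
        have "norm (F (Complex u t)) \<le> K * exp ((- \<theta> + \<theta> / 2) * \<bar>Im (Complex u t)\<bar>)"
          using False by (intro K) auto
        also have "(- \<theta> + \<theta> / 2) * \<bar>Im (Complex u t)\<bar> = - x" by (simp add: x_def field_simps)
        also have "K * exp (- x) \<le> K * inverse (m * (1 + t\<^sup>2))" using e K by (intro mult_left_mono)
        also have "\<dots> = K / m * inverse (1 + t\<^sup>2)" by (simp add: field_simps)
        also have "\<dots> \<le> (2 * B + K / m) * inverse (1 + t\<^sup>2)"
          using B pos by (intro mult_right_mono) auto
        finally show ?thesis .
      qed
      then show "norm (F (Complex u t)) \<le> norm ((2 * B + K / m) * inverse (1 + t\<^sup>2))"
        by (auto intro: order_trans[OF _ abs_ge_self])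
    qed
  qed
qed

lemma vertical_line_integrable_exp:
  assumes "\<not> is_pole F (of_real u)"
  shows "integrable lborel (\<lambda>t. F (Complex u t) * exp (- (Complex u t * of_real y)))"
proof (rule Bochner_Integration.integrable_bound)
  show "integrable lborel (\<lambda>t. F (Complex u t) * of_real (exp (- (u * y))))"
    by (intro integrable_mult_left vertical_line_integrable assms)
  have "continuous_on UNIV (\<lambda>t. F (Complex u t) * exp (- (Complex u t * of_real y)))"
    by (intro continuous_intros vertical_line_continuous assms continuous_on_Complex)
  then show "(\<lambda>t. F (Complex u t) * exp (- (Complex u t * of_real y))) \<in> borel_measurable lborel"
    using borel_measurable_continuous_onI by simp
qed (auto simp: norm_mult)

text \<open>Links the gauge integral over [-T, T] that contour integrals produce with the Lebesgue
  integral over the line. Heights \<open>Suc n\<close> keep \<open>T \<ge> 1\<close>, as required by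
  the decay bound on the horizontal edges.\<close>

lemma truncated_vertical_integral:
  assumes "\<not> is_pole F (of_real u)"
  shows "(\<lambda>n. integral {- real (Suc n)..real (Suc n)} (\<lambda>t. F (Complex u t) * exp (- (Complex u t * of_real y))))
    \<longlonglongrightarrow> (CLINT t|lborel. F (Complex u t) * exp (- (Complex u t * of_real y)))"
proof -
  let ?f = "\<lambda>t. F (Complex u t) * exp (- (Complex u t * of_real y))"
  note int = vertical_line_integrable_exp[OF assms, of y]
  have "integral {- real (Suc n)..real (Suc n)} ?f = (CLINT t|lborel. indicator {- real (Suc n)..real (Suc n)} t *\<^sub>R ?f t)" for n
    using set_borel_integral_eq_integral(2)[of "{- real (Suc n)..real (Suc n)}" ?f] int
    by (simp add: set_integrable_def set_lebesgue_integral_def integrable_mult_indicator)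
  moreover have "(\<lambda>n. CLINT t|lborel. indicator {- real (Suc n)..real (Suc n)} t *\<^sub>R ?f t) \<longlonglongrightarrow> (CLINT t|lborel. ?f t)"
  proof (rule integral_dominated_convergence[where w = "\<lambda>t. norm (?f t)"])
    show "AE t in lborel. (\<lambda>n. indicator {- real (Suc n)..real (Suc n)} t *\<^sub>R ?f t) \<longlonglongrightarrow> ?f t"
    proof (intro AE_I2 tendsto_eventually)
      fix t :: real
      show "\<forall>\<^sub>F n in sequentially. indicator {- real (Suc n)..real (Suc n)} t *\<^sub>R ?f t = ?f t"
        using eventually_ge_at_top[of "nat \<lceil>\<bar>t\<bar>\<rceil>"]
        by eventually_elim (auto simp: indicator_def)
    qed
  qed (use int in \<open>auto simp: indicator_def\<close>)
  ultimately show ?thesis by simp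
qed

text \<open>Residue theorem on the rectangle with vertical sides over \<open>u\<close> and
  \<open>v\<close> and height from -T to T. All poles are real, so the enclosed ones do not depend
  on T, and the horizontal sides vanish in the limit by the exponential decay.\<close>

lemma contour_shift:
  assumes uv: "u < v" and nu: "\<not> is_pole F (of_real u)" and nv: "\<not> is_pole F (of_real v)"
  shows "(CLINT t|lborel. F (Complex v t) * exp (- (Complex v t * of_real y))) =
     (CLINT t|lborel. F (Complex u t) * exp (- (Complex u t * of_real y))) +
     2 * pi * (\<Sum>\<rho> | u < \<rho> \<and> \<rho> < v \<and> is_pole F (of_real \<rho>). residue (\<lambda>s. F s * exp (- of_real y * s)) (of_real \<rho>))"
proof -
  define S where "S = (\<lambda>s. F s * exp (- of_real y * s))"
  \<comment> \<open>A slightly wider open strip: it contains the closed rectangles of all heights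
    but only finitely many poles.\<close>
  let ?W = "{s. u - 1 < Re s} \<inter> {s. Re s < v + 1}"
  define pts where "pts = {s. is_pole F s \<and> u - 1 < Re s \<and> Re s < v + 1}"
  define \<Sigma> where "\<Sigma> = (\<Sum>\<rho> | u < \<rho> \<and> \<rho> < v \<and> is_pole F (of_real \<rho>). residue S (of_real \<rho>))"
  have finpts: "finite pts"
    by (rule finite_subset[OF _ fin_poles[of "u - 1" "v + 1"]]) (auto simp: pts_def)
  have holS: "S holomorphic_on A" if "\<And>s. s \<in> A \<Longrightarrow> \<not> is_pole F s" for A
    unfolding S_def by (intro holomorphic_intros holomorphic_off_poles that)
  obtain K where K: "K \<ge> 0" "\<And>s. u \<le> Re s \<Longrightarrow> Re s \<le> v \<Longrightarrow> 1 \<le> \<bar>Im s\<bar> \<Longrightarrow>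
      norm (F s) \<le> K * exp ((- \<theta> + \<theta> / 2) * \<bar>Im s\<bar>)"
    using vertical_growthE[OF growth, of 1 "\<theta> / 2" u v] \<theta> by auto
  define E where "E = exp (\<bar>y\<bar> * max \<bar>u\<bar> \<bar>v\<bar>)"
  have Sbd: "norm (S s) \<le> K * E * exp (- (\<theta> / 2 * \<bar>Im s\<bar>))" if "u \<le> Re s" "Re s \<le> v" "1 \<le> \<bar>Im s\<bar>" for s
  proof -
    have "- (y * Re s) \<le> \<bar>y\<bar> * max \<bar>u\<bar> \<bar>v\<bar>"
    proof -
      have "- (y * Re s) \<le> \<bar>y\<bar> * \<bar>Re s\<bar>" by (simp add: abs_mult[symmetric])
      also have "\<dots> \<le> \<bar>y\<bar> * max \<bar>u\<bar> \<bar>v\<bar>" using that by (intro mult_left_mono) auto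
      finally show ?thesis .
    qed
    then have "norm (S s) \<le> (K * exp ((- \<theta> + \<theta> / 2) * \<bar>Im s\<bar>)) * E"
      unfolding S_def norm_mult E_def using that K(1) by (intro mult_mono K(2)) auto
    also have "\<dots> = K * E * exp (- (\<theta> / 2 * \<bar>Im s\<bar>))" by (simp add: field_simps)
    finally show ?thesis .
  qed
  have rect: "contour_integral (linepath (Complex u (- T)) (Complex v (- T))) S +
      \<i> * integral {-T..T} (\<lambda>t. S (Complex v t)) +
      contour_integral (linepath (Complex v T) (Complex u T)) S -
      \<i> * integral {-T..T} (\<lambda>t. S (Complex u t)) = 2 * pi * \<i> * \<Sigma>" if T: "T \<ge> 1" for T
  proof -
    define a1 a2 a3 a4 where "a1 = Complex u (-T)" and "a2 = Complex v (-T)" and "a3 = Complex v T" and "a4 = Complex u T"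
    define g where "g = rectpath a1 a3"
    have ga: "g = linepath a1 a2 +++ linepath a2 a3 +++ linepath a3 a4 +++ linepath a4 a1"
      by (simp add: g_def rectpath_def Let_def a1_def a2_def a3_def a4_def)
    have lines: "a1 \<in> cbox a1 a3" "a2 \<in> cbox a1 a3" "a3 \<in> cbox a1 a3" "a4 \<in> cbox a1 a3"
      using T uv by (auto simp: a1_def a2_def a3_def a4_def in_cbox_complex_iff)
    have pi: "path_image g = cbox a1 a3 - box a1 a3"
      unfolding g_def using T uv by (intro path_image_rectpath_cbox_minus_box) (auto simp: a1_def a3_def)
    have nopole: "\<not> is_pole F s" if "s \<in> path_image g" for s
    proof
      assume p: "is_pole F s"
      then have "Im s = 0" by (rule real_poles)
      with that T have "Re s = u \<or> Re s = v"
        unfolding pi by (auto simp: a1_def a3_def in_cbox_complex_iff in_box_complex_iff)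
      with \<open>Im s = 0\<close> have "s = of_real u \<or> s = of_real v" by (auto simp: complex_eq_iff)
      with p nu nv show False by auto
    qed
    have "contour_integral g S = 2 * pi * \<i> * (\<Sum>p\<in>pts. winding_number g p * residue S p)"
    proof (rule Residue_theorem)
      show "open ?W" by (intro open_Int open_halfspace_Re_gt open_halfspace_Re_lt)
      show "connected ?W" by (intro convex_connected convex_Int convex_halfspace_Re_gt convex_halfspace_Re_lt)
      show "finite pts" by fact
      show "S holomorphic_on ?W - pts" by (intro holS) (auto simp: pts_def)
      show "valid_path g" "pathfinish g = pathstart g" by (simp_all add: g_def)
      show "path_image g \<subseteq> ?W - pts"
        using nopole uv unfolding pts_def by (auto simp: pi a1_def a3_def in_cbox_complex_iff)
      show "\<forall>z. z \<notin> ?W \<longrightarrow> winding_number g z = 0"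
        unfolding g_def using uv T
        by (intro allI impI winding_number_rectpath_outside) (auto simp: a1_def a3_def in_cbox_complex_iff)
    qed
    \<comment> \<open>The strip also contains poles outside the rectangle, with winding number 0;
      those inside have winding number 1. None lies on the boundary, because \<open>u\<close> and
      \<open>v\<close> are no poles.\<close>
    also have "(\<Sum>p\<in>pts. winding_number g p * residue S p) =
        (\<Sum>p \<in> of_real ` {\<rho>. u < \<rho> \<and> \<rho> < v \<and> is_pole F (of_real \<rho>)}. residue S p)"
    proof (rule sum.mono_neutral_cong_right[OF finpts])
      show "of_real ` {\<rho>. u < \<rho> \<and> \<rho> < v \<and> is_pole F (of_real \<rho>)} \<subseteq> pts" by (auto simp: pts_def)
      show "\<forall>p\<in>pts - of_real ` {\<rho>. u < \<rho> \<and> \<rho> < v \<and> is_pole F (of_real \<rho>)}. winding_number g p * residue S p = 0"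
      proof
        fix p assume p: "p \<in> pts - of_real ` {\<rho>. u < \<rho> \<and> \<rho> < v \<and> is_pole F (of_real \<rho>)}"
        then have pole: "is_pole F p" by (simp add: pts_def)
        have pr: "p = of_real (Re p)" using real_poles[OF pole] by (simp add: complex_eq_iff)
        have "\<not> (u < Re p \<and> Re p < v)" using p pole pr by (metis (mono_tags, lifting) DiffD2 image_eqI mem_Collect_eq)
        moreover have "Re p \<noteq> u" "Re p \<noteq> v" using nu nv pole pr by metis+
        ultimately have "p \<notin> cbox a1 a3" by (auto simp: a1_def a3_def in_cbox_complex_iff)
        then have "winding_number g p = 0"
          unfolding g_def using uv T by (intro winding_number_rectpath_outside) (auto simp: a1_def a3_def)
        then show "winding_number g p * residue S p = 0" by simp
      qed
      fix p :: complex assume "p \<in> of_real ` {\<rho>. u < \<rho> \<and> \<rho> < v \<and> is_pole F (of_real \<rho>)}"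
      then have "p \<in> box a1 a3" using T by (auto simp: a1_def a3_def in_box_complex_iff)
      then show "winding_number g p * residue S p = residue S p"
        unfolding g_def by (simp add: winding_number_rectpath)
    qed
    also have "\<dots> = \<Sigma>" unfolding \<Sigma>_def by (subst sum.reindex) (auto simp: inj_on_def)
    finally have 1: "contour_integral g S = 2 * pi * \<i> * \<Sigma>" .
    have pis: "path_image g = closed_segment a1 a2 \<union> closed_segment a2 a3 \<union> closed_segment a3 a4 \<union> closed_segment a4 a1"
      unfolding ga by (simp add: path_image_join Un_assoc)
    have int: "S contour_integrable_on linepath a1 a2" "S contour_integrable_on linepath a2 a3"
      "S contour_integrable_on linepath a3 a4" "S contour_integrable_on linepath a4 a1"
      by (intro contour_integrable_continuous_linepath holomorphic_on_imp_continuous_on holS nopole, simp add: pis)+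
    have "contour_integral g S = contour_integral (linepath a1 a2) S + (contour_integral (linepath a2 a3) S +
        (contour_integral (linepath a3 a4) S + contour_integral (linepath a4 a1) S))"
      unfolding ga using int by (simp add: contour_integral_join contour_integrable_joinI valid_path_join)
    moreover have "contour_integral (linepath a2 a3) S = \<i> * integral {-T..T} (\<lambda>t. S (Complex v t))"
      using T by (intro contour_integral_linepath_same_Re) (auto simp: a2_def a3_def)
    moreover have "contour_integral (linepath a4 a1) S = - contour_integral (linepath a1 a4) S"
      using contour_integral_reversepath[of "linepath a1 a4" S] by simp
    moreover have "contour_integral (linepath a1 a4) S = \<i> * integral {-T..T} (\<lambda>t. S (Complex u t))"
      using T by (intro contour_integral_linepath_same_Re) (auto simp: a1_def a4_def)
    ultimately show ?thesis using 1 by (simp add: a1_def a2_def a3_def a4_def)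
  qed
  \<comment> \<open>The sign \<open>c\<close> selects the upper or lower edge, and \<open>x\<close>,
    \<open>x'\<close> its orientation.\<close>
  have hor: "(\<lambda>n. contour_integral (linepath (Complex x (c * real (Suc n))) (Complex x' (c * real (Suc n)))) S) \<longlonglongrightarrow> 0"
    if c: "\<bar>c\<bar> = 1" and x: "x \<in> {u, v}" "x' \<in> {u, v}" for c x x' :: real
  proof (rule Lim_null_comparison)
    show "\<forall>\<^sub>F n in sequentially. norm (contour_integral (linepath (Complex x (c * real (Suc n))) (Complex x' (c * real (Suc n)))) S)
        \<le> K * E * exp (- (\<theta> / 2 * real (Suc n))) * (v - u)"
    proof (intro always_eventually allI)
      fix n
      let ?p = "Complex x (c * real (Suc n))" and ?q = "Complex x' (c * real (Suc n))"
      have seg: "u \<le> Re s \<and> Re s \<le> v \<and> \<bar>Im s\<bar> = real (Suc n)" if "s \<in> closed_segment ?p ?q" for s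
      proof -
        from that have "\<exists>w. 0 \<le> w \<and> w \<le> 1 \<and> s = (1 - w) *\<^sub>R ?p + w *\<^sub>R ?q"
          by (simp only: in_segment)
        then obtain w where w: "0 \<le> w" "w \<le> 1" "s = (1 - w) *\<^sub>R ?p + w *\<^sub>R ?q"
          by (elim exE conjE)
        have "Im s = (1 - w) * (c * real (Suc n)) + w * (c * real (Suc n))" "Re s = (1 - w) * x + w * x'"
          by (simp_all only: w(3) plus_complex.sel scaleR_complex.sel complex.sel)
        then have "Im s = c * real (Suc n)" "Re s \<in> closed_segment x x'"
          using w(1,2) by (simp_all only: left_diff_distrib) (auto simp: in_segment left_diff_distrib)
        moreover have "closed_segment x x' \<subseteq> {u..v}"
          using x uv by (auto simp: closed_segment_eq_real_ivl)
        moreover have "\<bar>c * real (Suc n)\<bar> = real (Suc n)" unfolding abs_mult c by simp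
        ultimately show ?thesis by auto
      qed
      have "\<not> is_pole F s" if "s \<in> closed_segment ?p ?q" for s
        using seg[OF that] real_poles[of s] by auto
      then have int: "S contour_integrable_on linepath ?p ?q"
        by (intro contour_integrable_continuous_linepath holomorphic_on_imp_continuous_on holS)
      have "norm (contour_integral (linepath ?p ?q) S) \<le> K * E * exp (- (\<theta> / 2 * real (Suc n))) * norm (?q - ?p)"
      proof (rule contour_integral_bound_linepath[OF int])
        show "norm (S s) \<le> K * E * exp (- (\<theta> / 2 * real (Suc n)))" if "s \<in> closed_segment ?p ?q" for s
          using seg[OF that] Sbd[of s] by auto
      qed (use K in \<open>auto simp: E_def\<close>)
      also have "?q - ?p = of_real (x' - x)" by (simp add: complex_eq_iff)
      also have "norm (complex_of_real (x' - x)) \<le> v - u"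
        unfolding norm_of_real using x uv by auto
      finally show "norm (contour_integral (linepath ?p ?q) S) \<le> K * E * exp (- (\<theta> / 2 * real (Suc n))) * (v - u)"
        using K by (simp add: mult_left_mono E_def)
    qed
    have "(\<lambda>n. exp (- (\<theta> / 2 * real (Suc n)))) \<longlonglongrightarrow> 0"
      using \<theta> by real_asymp
    then show "(\<lambda>n. K * E * exp (- (\<theta> / 2 * real (Suc n))) * (v - u)) \<longlonglongrightarrow> 0"
      using tendsto_mult_left_zero tendsto_mult_right_zero by blast
  qed
  have SE: "S s = F s * exp (- (s * of_real y))" for s by (simp add: S_def mult.commute)
  let ?U = "CLINT t|lborel. F (Complex u t) * exp (- (Complex u t * of_real y))"
  let ?V = "CLINT t|lborel. F (Complex v t) * exp (- (Complex v t * of_real y))"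
  have "(\<lambda>n. contour_integral (linepath (Complex u ((-1) * real (Suc n))) (Complex v ((-1) * real (Suc n)))) S +
      \<i> * integral {-real (Suc n)..real (Suc n)} (\<lambda>t. S (Complex v t)) +
      contour_integral (linepath (Complex v (1 * real (Suc n))) (Complex u (1 * real (Suc n)))) S -
      \<i> * integral {-real (Suc n)..real (Suc n)} (\<lambda>t. S (Complex u t))) \<longlonglongrightarrow> 0 + \<i> * ?V + 0 - \<i> * ?U"
    unfolding SE[of "Complex u _"] SE[of "Complex v _"]
    by (intro tendsto_intros hor truncated_vertical_integral nu nv) auto
  moreover have "(\<lambda>n. contour_integral (linepath (Complex u ((-1) * real (Suc n))) (Complex v ((-1) * real (Suc n)))) S +
      \<i> * integral {-real (Suc n)..real (Suc n)} (\<lambda>t. S (Complex v t)) +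
      contour_integral (linepath (Complex v (1 * real (Suc n))) (Complex u (1 * real (Suc n)))) S -
      \<i> * integral {-real (Suc n)..real (Suc n)} (\<lambda>t. S (Complex u t))) = (\<lambda>n. 2 * pi * \<i> * \<Sigma>)"
    using rect[of "real (Suc _)"] by (auto simp: fun_eq_iff)
  ultimately have "2 * pi * \<i> * \<Sigma> = \<i> * ?V - \<i> * ?U"
    using LIMSEQ_unique[OF tendsto_const] by auto
  then have "\<i> * ?V = \<i> * (?U + 2 * pi * \<Sigma>)" by (simp add: algebra_simps)
  then have "?V = ?U + 2 * pi * \<Sigma>" by (simp only: mult_cancel_left) simp
  then show ?thesis unfolding \<Sigma>_def S_def .
qed

end

section \<open>Densities under the exponential map and asymptotic transfer\<close>

text \<open>Two densities of one law agree almost everywhere, and the part of \<open>S\<close> where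
  they differ is open, hence empty once it is null. This carries results from the constructed
  densities over to arbitrary \<open>fX\<close> and \<open>fY\<close>.\<close>

lemma density_continuous_on_unique:
  assumes "density_continuous_on M Z S f" "density_continuous_on M Z S g" "open S" "x \<in> S"
  shows "f x = g x"
proof -
  have d: "distributed M lborel Z (\<lambda>x. ennreal (f x))" "distributed M lborel Z (\<lambda>x. ennreal (g x))"
    and nn: "\<And>x. 0 \<le> f x" "\<And>x. 0 \<le> g x" and cont: "continuous_on S f" "continuous_on S g"
    using assms unfolding density_continuous_on_def by auto
  have [measurable]: "(\<lambda>x. ennreal (f x)) \<in> borel_measurable lborel" "(\<lambda>x. ennreal (g x)) \<in> borel_measurable lborel"
    using d unfolding distributed_def by auto
  have "density lborel (\<lambda>x. ennreal (f x)) = density lborel (\<lambda>x. ennreal (g x))"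
    using d unfolding distributed_def by simp
  then have "AE x in lborel. ennreal (f x) = ennreal (g x)"
    by (intro sigma_finite_measure.density_unique[OF sigma_finite_lborel]) auto
  then have ae: "AE x in lborel. f x = g x"
    by (rule AE_mp) (use nn in simp)
  define U where "U = S \<inter> (\<lambda>x. f x - g x) -` (- {0})"
  have "open U" unfolding U_def
    by (intro continuous_open_preimage continuous_intros cont assms)
  have "AE x in lborel. x \<notin> U" using ae by eventually_elim (simp add: U_def)
  then have "U \<in> null_sets lborel"
    using \<open>open U\<close> by (simp add: AE_iff_null_sets borel_open)
  then have "negligible U" unfolding negligible_iff_null_sets by (rule null_sets_completionI)
  then have "U = {}" using open_not_negligible[OF \<open>open U\<close>] by blast
  then show ?thesis using assms(4) unfolding U_def by auto
qed

text \<open>Change of variables \<open>x = exp y\<close>, which maps the line onto the positive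
  half-line. The underlying theorem concerns absolutely integrable functions, hence the detour
  through real-valued integrals.\<close>

lemma nn_integral_ln_substitution:
  fixes h :: "real \<Rightarrow> real"
  assumes [measurable]: "h \<in> borel_measurable borel" and nn: "\<And>y. 0 \<le> h y" and int: "integrable lborel h"
  shows "(\<integral>\<^sup>+x. ennreal (if x > 0 then h (ln x) / x else 0) \<partial>lborel) = (\<integral>\<^sup>+y. ennreal (h y) \<partial>lborel)"
proof -
  define k where "k = (\<lambda>x. if x > 0 then h (ln x) / x else 0)"
  have k[measurable]: "k \<in> borel_measurable borel" unfolding k_def by measurable
  have exp_range: "range exp = {0::real<..}"
    by (auto simp: image_iff) (metis exp_ln)
  have "h absolutely_integrable_on UNIV" "integral UNIV h = (LINT y|lborel. h y)"
    using int by (simp_all add: set_integrable_def integrable_completion integral_unique[OF has_integral_integral_lborel])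
  moreover have "(\<lambda>x. \<bar>exp x\<bar> * k (exp x)) = h" by (simp add: k_def fun_eq_iff)
  moreover have "inj (exp :: real \<Rightarrow> real)" by (auto simp: inj_on_def)
  ultimately have "k absolutely_integrable_on {0<..} \<and> integral {0<..} k = (LINT y|lborel. h y)"
    using has_absolute_integral_change_of_variables_1'[of UNIV exp exp k "LINT y|lborel. h y"]
    by (simp add: exp_range DERIV_exp)
  then have "(k has_integral (LINT y|lborel. h y)) {0<..}"
    using set_lebesgue_integral_eq_integral(1) by (metis integrable_integral)
  then have "(k has_integral (LINT y|lborel. h y)) UNIV"
    by (rule has_integral_on_superset) (auto simp: k_def)
  then have "(\<integral>\<^sup>+x. ennreal (k x) \<partial>lborel) = ennreal (LINT y|lborel. h y)"
    using nn by (intro nn_integral_has_integral_lborel k) (auto simp: k_def)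
  also have "\<dots> = (\<integral>\<^sup>+y. ennreal (h y) \<partial>lborel)"
    using int nn by (simp add: nn_integral_eq_integral)
  finally show ?thesis unfolding k_def .
qed

text \<open>The law of \<open>X\<close> is recovered from that of its logarithm because
  \<open>exp (ln (X \<omega>)) = X \<omega>\<close> almost surely. The value 0 for
  \<open>x \<le> 0\<close> is needed since the density lives on the whole line.\<close>

lemma (in prob_space) density_exp_transform:
  fixes X :: "'a \<Rightarrow> real"
  assumes [measurable]: "X \<in> borel_measurable M" and pos: "AE \<omega> in M. X \<omega> > 0"
    and g: "density_continuous_on M (\<lambda>\<omega>. ln (X \<omega>)) UNIV g"
  shows "density_continuous_on M X {0<..} (\<lambda>x. if x > 0 then g (ln x) / x else 0)"
proof -
  define f where "f = (\<lambda>x. if x > 0 then g (ln x) / x else 0)"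
  have d: "distr M lborel (\<lambda>\<omega>. ln (X \<omega>)) = density lborel (\<lambda>x. ennreal (g x))"
    and nn: "\<And>x. 0 \<le> g x" and cont: "continuous_on UNIV g"
    using g unfolding density_continuous_on_def distributed_def by auto
  have [measurable]: "g \<in> borel_measurable borel" by (rule borel_measurable_continuous_onI[OF cont])
  have [measurable]: "f \<in> borel_measurable borel" unfolding f_def by measurable
  have "(\<integral>\<^sup>+x. ennreal (g x) \<partial>lborel) = emeasure (distr M lborel (\<lambda>\<omega>. ln (X \<omega>))) UNIV"
    unfolding d by (simp add: emeasure_density)
  also have "\<dots> = 1" by (subst emeasure_distr) (auto simp: emeasure_space_1)
  finally have intg: "integrable lborel g" using nn by (intro integrableI_nonneg) auto
  have "distr M lborel X = density lborel (\<lambda>x. ennreal (f x))"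
  proof (rule measure_eqI)
    fix A assume "A \<in> sets (distr M lborel X)"
    then have [measurable]: "A \<in> sets borel" by simp
    have "emeasure (distr M lborel X) A = (\<integral>\<^sup>+\<omega>. indicator A (X \<omega>) \<partial>M)"
      by (subst nn_integral_indicator[symmetric], simp, subst nn_integral_distr) auto
    also have "\<dots> = (\<integral>\<^sup>+\<omega>. indicator A (exp (ln (X \<omega>))) \<partial>M)"
      using pos by (intro nn_integral_cong_AE) (auto elim!: eventually_mono)
    also have "\<dots> = (\<integral>\<^sup>+y. indicator A (exp y) \<partial>distr M lborel (\<lambda>\<omega>. ln (X \<omega>)))"
      by (subst nn_integral_distr) auto
    also have "\<dots> = (\<integral>\<^sup>+y. ennreal (g y) * indicator A (exp y) \<partial>lborel)"
      unfolding d by (subst nn_integral_density) auto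
    also have "\<dots> = (\<integral>\<^sup>+y. ennreal (g y * indicator A (exp y)) \<partial>lborel)"
      by (intro nn_integral_cong) (auto simp: indicator_def)
    also have "\<dots> = (\<integral>\<^sup>+x. ennreal (if x > 0 then g (ln x) * indicator A (exp (ln x)) / x else 0) \<partial>lborel)"
    proof (rule nn_integral_ln_substitution[symmetric])
      show "integrable lborel (\<lambda>y. g y * indicator A (exp y))"
        by (rule Bochner_Integration.integrable_bound[OF intg]) (auto simp: indicator_def nn)
    qed (auto simp: nn)
    also have "\<dots> = (\<integral>\<^sup>+x. ennreal (f x) * indicator A x \<partial>lborel)"
      by (intro nn_integral_cong) (auto simp: f_def indicator_def)
    also have "\<dots> = emeasure (density lborel (\<lambda>x. ennreal (f x))) A"
      by (subst emeasure_density) auto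
    finally show "emeasure (distr M lborel X) A = emeasure (density lborel (\<lambda>x. ennreal (f x))) A" .
  qed simp
  moreover have "continuous_on {0<..} f"
  proof (rule continuous_on_eq)
    show "continuous_on {0<..} (\<lambda>x. g (ln x) / x)"
      by (intro continuous_intros continuous_on_compose2[OF cont]) auto
  qed (simp add: f_def)
  moreover have "0 \<le> f x" for x using nn by (simp add: f_def)
  ultimately show ?thesis
    unfolding density_continuous_on_def distributed_def f_def[symmetric] by simp
qed

text \<open>Supplies a new line of integration just left of \<open>m\<close>, with no pole in
  between. \<open>\<epsilon> < 1\<close> matters because only the poles in [m - 1, m] are put into
  \<open>A\<close>.\<close>

lemma finite_left_gap:
  fixes A :: "real set"
  assumes "finite A"
  obtains \<epsilon> where "\<epsilon> > 0" "\<epsilon> < 1" "\<And>x. x \<in> A \<Longrightarrow> x < m \<Longrightarrow> x < m - \<epsilon>"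
proof -
  have "\<exists>\<epsilon>>0. \<epsilon> < 1 \<and> (\<forall>x\<in>A. x < m \<longrightarrow> x < m - \<epsilon>)"
    using assms
  proof (induction A rule: finite_induct)
    case empty
    then show ?case by (intro exI[of _ "1/2"]) auto
  next
    case (insert x A)
    then obtain \<epsilon> where \<epsilon>: "\<epsilon> > 0" "\<epsilon> < 1" "\<forall>x\<in>A. x < m \<longrightarrow> x < m - \<epsilon>" by blast
    show ?case
      using \<epsilon> by (intro exI[of _ "if x < m then min \<epsilon> ((m - x) / 2) else \<epsilon>"]) (auto simp: min_def field_simps)
  qed
  then show ?thesis using that by blast
qed

section \<open>Transfer of asymptotics by the substitution y = ln x, and the leading term\<close>

lemma bigo_exp_to_powr:
  fixes h :: "real \<Rightarrow> complex"
  assumes h: "h \<in> O[at_bot](\<lambda>y. of_real (exp (s * y)))"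
    and k: "\<And>x. x > 0 \<Longrightarrow> k x = h (ln x) / of_real x"
  shows "k \<in> O[at_right 0](\<lambda>x. of_real (x powr (s - 1)))"
proof -
  have "(\<lambda>x. h (ln x) * (1 / of_real x)) \<in> O[at_right 0](\<lambda>x. of_real (exp (s * ln x)) * (1 / of_real x))"
    by (intro landau_o.big.mult_right landau_o.big.compose[OF h ln_at_0])
  moreover have pos: "\<forall>\<^sub>F x::real in at_right 0. x > 0" by (rule eventually_at_right_less)
  have 1: "\<forall>\<^sub>F x in at_right 0. h (ln x) * (1 / of_real x) = k x"
    using pos by eventually_elim (simp add: k)
  have 2: "\<forall>\<^sub>F x in at_right 0. of_real (exp (s * ln x)) * (1 / of_real x) = complex_of_real (x powr (s - 1))"
    using pos by eventually_elim (simp add: powr_def left_diff_distrib exp_diff)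
  ultimately show ?thesis unfolding landau_o.big.in_cong[OF 1] landau_o.big.cong[OF 2] by simp
qed

lemma asymp_equiv_ln_transform:
  fixes h h' :: "real \<Rightarrow> complex"
  assumes h: "h \<sim>[at_bot] h'"
    and k: "\<And>x. x > 0 \<Longrightarrow> k x = h (ln x) / of_real x" "\<And>x. x > 0 \<Longrightarrow> k' x = h' (ln x) / of_real x"
  shows "k \<sim>[at_right 0] k'"
proof -
  have "(\<lambda>x. h (ln x) * (1 / of_real x)) \<sim>[at_right 0] (\<lambda>x. h' (ln x) * (1 / of_real x))"
    by (intro asymp_equiv_mult asymp_equiv_compose'[OF h ln_at_0] asymp_equiv_refl)
  moreover have pos: "\<forall>\<^sub>F x::real in at_right 0. x > 0" by (rule eventually_at_right_less)
  have "\<forall>\<^sub>F x in at_right 0. h (ln x) * (1 / of_real x) = k x"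
       "\<forall>\<^sub>F x in at_right 0. h' (ln x) * (1 / of_real x) = k' x"
    using pos by (eventually_elim, simp add: k)+
  from asymp_equiv_cong[OF this] show ?thesis using calculation by simp
qed

text \<open>Relative to the top power of \<open>- y\<close>, lower powers lose at least one factor
  \<open>- y\<close> and the remainder loses \<open>exp (\<eta> * y)\<close>. Both are negligible
  against the leading term because its coefficient is nonzero.\<close>

lemma exp_times_polynomial_asymp:
  fixes h :: "real \<Rightarrow> complex" and c :: "nat \<Rightarrow> complex"
  assumes h: "(\<lambda>y. h y - of_real (exp (s * y)) * (\<Sum>l<\<nu>. c l * of_real ((- y) ^ l))) \<in> O[at_bot](\<lambda>y. of_real (exp ((s + \<eta>) * y)))"
    and \<eta>: "\<eta> > 0" and \<nu>: "\<nu> \<ge> 1" and c: "c (\<nu> - 1) \<noteq> 0"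
  shows "h \<sim>[at_bot] (\<lambda>y. c (\<nu> - 1) * of_real (exp (s * y) * (- y) ^ (\<nu> - 1)))"
proof -
  define n where "n = \<nu> - 1"
  have \<nu>n: "\<nu> = Suc n" using \<nu> by (simp add: n_def)
  define L where "L = (\<lambda>y::real. exp (s * y) * (- y) ^ n)"
  have lower: "(\<lambda>y::real. exp (s * y) * (- y) ^ l) \<in> o[at_bot](L)" if "l < n" for l
  proof -
    have "((\<lambda>y::real. inverse ((- y) ^ (n - l))) \<longlongrightarrow> 0) at_bot"
      using that by (intro tendsto_inverse_0_at_top filterlim_pow_at_top filterlim_uminus_at_top_at_bot) auto
    moreover have "\<forall>\<^sub>F y::real in at_bot. inverse ((- y) ^ (n - l)) = exp (s * y) * (- y) ^ l / L y"
      using eventually_gt_at_bot[of 0]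
    proof eventually_elim
      case (elim y)
      have "(- y) ^ n = (- y) ^ l * (- y) ^ (n - l)" using that by (simp flip: power_add)
      then show ?case using elim by (simp add: L_def field_simps)
    qed
    ultimately have "((\<lambda>y. exp (s * y) * (- y) ^ l / L y) \<longlongrightarrow> 0) at_bot" by (rule Lim_transform_eventually)
    moreover have "\<forall>\<^sub>F y::real in at_bot. L y \<noteq> 0"
      using eventually_gt_at_bot[of 0] by eventually_elim (simp add: L_def)
    ultimately show ?thesis by (intro smalloI_tendsto) auto
  qed
  have rem: "(\<lambda>y::real. exp ((s + \<eta>) * y)) \<in> o[at_bot](L)"
  proof -
    have "(\<lambda>y::real. exp ((s + \<eta>) * y)) \<in> o[at_bot](\<lambda>y. exp (s * y))"
    proof (rule smalloI_tendsto)
      have "((\<lambda>y. exp (\<eta> * y)) \<longlongrightarrow> 0) at_bot"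
        by (intro filterlim_compose[OF exp_at_bot] filterlim_tendsto_pos_mult_at_bot[OF tendsto_const \<eta>] filterlim_ident)
      then show "((\<lambda>y. exp ((s + \<eta>) * y) / exp (s * y)) \<longlongrightarrow> 0) at_bot"
        by (simp add: distrib_right exp_add)
    qed auto
    \<comment> \<open>For \<open>y \<le> -1\<close> the power \<open>(- y) ^ n\<close> is at least
      1, so dropping it only decreases the value.\<close>
    also have "(\<lambda>y::real. exp (s * y)) \<in> O[at_bot](L)"
    proof (rule bigoI[where c = 1])
      show "\<forall>\<^sub>F y::real in at_bot. norm (exp (s * y)) \<le> 1 * norm (L y)"
        using eventually_le_at_bot[of "-1"]
      proof eventually_elim
        case (elim y)
        then have "1 \<le> (- y) ^ n" by (intro one_le_power) auto
        then have "exp (s * y) * 1 \<le> L y" unfolding L_def by (intro mult_left_mono) auto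
        then show ?case by (auto intro: order_trans[OF _ abs_ge_self])
      qed
    qed
    finally show ?thesis .
  qed
  let ?C = "\<lambda>y. c n * of_real (L y)"
  have toC: "f \<in> o[at_bot](?C)" if "f \<in> o[at_bot](\<lambda>y. complex_of_real (L y))" for f
    using that c by (simp add: n_def)
  have "(\<lambda>y. h y - ?C y) = (\<lambda>y. (h y - of_real (exp (s * y)) * (\<Sum>l<\<nu>. c l * of_real ((- y) ^ l))) +
       (\<Sum>l<n. c l * of_real (exp (s * y) * (- y) ^ l)))"
    by (auto simp: \<nu>n L_def sum_distrib_left algebra_simps)
  also have "\<dots> \<in> o[at_bot](?C)"
  proof (rule sum_in_smallo(1))
    have "(\<lambda>y. complex_of_real (exp ((s + \<eta>) * y))) \<in> o[at_bot](\<lambda>y. complex_of_real (L y))"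
      using rem by (simp add: landau_o.small.of_real_iff)
    with h have "(\<lambda>y. h y - of_real (exp (s * y)) * (\<Sum>l<\<nu>. c l * of_real ((- y) ^ l))) \<in> o[at_bot](\<lambda>y. complex_of_real (L y))"
      by (rule landau_o.big_small_trans)
    then show "(\<lambda>y. h y - of_real (exp (s * y)) * (\<Sum>l<\<nu>. c l * of_real ((- y) ^ l))) \<in> o[at_bot](?C)" by (rule toC)
    show "(\<lambda>y. \<Sum>l<n. c l * of_real (exp (s * y) * (- y) ^ l)) \<in> o[at_bot](?C)"
    proof (intro toC big_sum_in_smallo)
      fix l assume "l \<in> {..<n}"
      then have "(\<lambda>y. complex_of_real (exp (s * y) * (- y) ^ l)) \<in> o[at_bot](\<lambda>y. complex_of_real (L y))"
        using lower[of l] by (subst landau_o.small.of_real_iff) auto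
      then show "(\<lambda>y. c l * complex_of_real (exp (s * y) * (- y) ^ l)) \<in> o[at_bot](\<lambda>y. complex_of_real (L y))"
        by (cases "c l = 0") simp_all
    qed
  qed
  finally have "h \<sim>[at_bot] ?C" by (rule smallo_imp_asymp_equiv)
  then show ?thesis by (simp add: L_def n_def)
qed

section \<open>The asymptotic expansion\<close>

context vertically_decaying
begin

lemma finite_real_poles: "finite {x. x1 \<le> x \<and> x \<le> x2 \<and> is_pole F (of_real x)}"
proof (rule finite_imageD)
  show "finite (complex_of_real ` {x. x1 \<le> x \<and> x \<le> x2 \<and> is_pole F (of_real x)})"
    by (rule finite_subset[OF _ fin_poles[of x1 x2]]) auto
qed (auto simp: inj_on_def)

lemma has_laurent_expansion_at:
  "(\<lambda>x. F (z + x)) has_laurent_expansion laurent_expansion F z"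
proof -
  have "F meromorphic_on {z}"
    using mero meromorphic_on_subset unfolding nicely_meromorphic_on_def by blast
  then show ?thesis
    by (intro not_essential_has_laurent_expansion meromorphic_on_isolated_singularity meromorphic_on_not_essential)
qed

text \<open>\<open>GREATEST\<close> is meaningful here: to the right of any given negative pole
  \<open>x0\<close> there are only finitely many further ones below 0, so a maximum exists. The
  point 0 is discarded from the finite set, as it might be a pole of a general
  \<open>F\<close>.\<close>

lemma rho_minus_greatest_pole:
  assumes "rho_minus F > -\<infinity>"
  defines "r \<equiv> real_of_ereal (rho_minus F)"
  shows "r < 0" "is_pole F (of_real r)" "\<And>x. x < 0 \<Longrightarrow> is_pole F (of_real x) \<Longrightarrow> x \<le> r"
proof -
  have ex: "\<exists>x::real. x < 0 \<and> is_pole F (of_real x)"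
    using assms(1) unfolding rho_minus_def by (auto split: if_splits)
  then obtain x0 :: real where x0: "x0 < 0" "is_pole F (of_real x0)" by blast
  define A where "A = {x. x0 \<le> x \<and> x \<le> 0 \<and> is_pole F (of_real x)} - {0}"
  have A: "finite A" "x0 \<in> A" unfolding A_def using finite_real_poles[of x0 0] x0 by auto
  define m where "m = Max A"
  have m: "m \<in> A" "\<And>x. x \<in> A \<Longrightarrow> x \<le> m" using A unfolding m_def by (auto intro: Max_in)
  have mA: "m < 0" "is_pole F (of_real m)" using m(1) by (auto simp: A_def)
  have max: "x \<le> m" if "x < 0" "is_pole F (of_real x)" for x
    using m(2)[of x] m(2)[OF A(2)] that by (cases "x0 \<le> x") (auto simp: A_def)
  have "(GREATEST x. x < 0 \<and> is_pole F (of_real x)) = m"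
    using mA max by (intro Greatest_equality) auto
  then have "r = m" unfolding r_def rho_minus_def using ex by simp
  then show "r < 0" "is_pole F (of_real r)" "\<And>x. x < 0 \<Longrightarrow> is_pole F (of_real x) \<Longrightarrow> x \<le> r"
    using mA max by auto
qed

text \<open>The coefficient belonging to the order of the pole is the one at the subdegree of the
  Laurent series. That it does not vanish is what makes the leading-term equivalence valid.\<close>

lemma pole_order_pos:
  assumes "is_pole F z"
  shows "pole_order F z \<ge> 1" "singular_coeff F z (pole_order F z) \<noteq> 0"
proof -
  note L = has_laurent_expansion_at[of z]
  have sd: "fls_subdegree (laurent_expansion F z) < 0"
    using has_laurent_expansion_imp_is_pole_iff[OF L] assms by simp
  then have nz: "laurent_expansion F z \<noteq> 0" by auto
  then have "zorder F z = fls_subdegree (laurent_expansion F z)" by (rule has_laurent_expansion_zorder[OF L])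
  then have *: "pole_order F z = nat (- fls_subdegree (laurent_expansion F z))" by (simp add: pole_order_def)
  then show "pole_order F z \<ge> 1" using sd by simp
  have "- int (pole_order F z) = fls_subdegree (laurent_expansion F z)" using * sd by simp
  then show "singular_coeff F z (pole_order F z) \<noteq> 0"
    unfolding singular_coeff_def using nz by simp
qed

lemma residue_eq_singular_coeff: "residue F z = singular_coeff F z 1"
  using has_laurent_expansion_residue[OF has_laurent_expansion_at[of z]] by (simp add: singular_coeff_def)

text \<open>The line is moved from \<open>c\<close> to some \<open>u < - \<sigma>\<close>. On the
  new line \<open>\<bar>exp (- s * y)\<bar> = exp (- u * y)\<close>, so the remaining integral is of
  order \<open>exp (\<sigma>' * y)\<close> with \<open>\<sigma>' = - u > \<sigma>\<close>; the
  strict inequality is needed for the first part of the theorem.\<close>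

lemma inverse_mellin_expansion:
  fixes g :: "real \<Rightarrow> real"
  assumes nopole: "\<forall>x\<in>{min 0 c..max 0 c}. \<not> is_pole F (of_real x)"
    and g: "\<And>y. complex_of_real (g y) = 1 / (2 * pi) * (CLINT t|lborel. F (Complex c t) * exp (- (Complex c t * of_real y)))"
    and \<sigma>: "\<sigma> > 0"
  shows "\<exists>\<sigma>'>\<sigma>. (\<lambda>y. complex_of_real (g y) -
     (\<Sum>\<rho> | 0 > \<rho> \<and> \<rho> \<ge> -\<sigma> \<and> is_pole F (of_real \<rho>). \<Sum>l<pole_order F (of_real \<rho>).
        singular_coeff F (of_real \<rho>) (l + 1) / fact l * of_real (exp (\<bar>\<rho>\<bar> * y) * (- y) ^ l)))
     \<in> O[at_bot](\<lambda>y. of_real (exp (\<sigma>' * y)))"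
proof -
  \<comment> \<open>The minimum with \<open>c\<close> ensures a shift to the left even when
    \<open>c\<close> is already below \<open>- \<sigma>\<close>; in that case no poles are
    collected.\<close>
  define m where "m = min (- \<sigma>) c"
  obtain \<epsilon> where \<epsilon>: "\<epsilon> > 0" "\<epsilon> < 1"
    "\<And>x. x \<in> {x. m - 1 \<le> x \<and> x \<le> m \<and> is_pole F (of_real x)} \<Longrightarrow> x < m \<Longrightarrow> x < m - \<epsilon>"
    using finite_left_gap[OF finite_real_poles[of "m - 1" m]] by metis
  define u where "u = m - \<epsilon>"
  have gap: "\<not> is_pole F (of_real x)" if "u \<le> x" "x < m" for x
    using \<epsilon>(3)[of x] that \<epsilon>(1,2) by (auto simp: u_def)
  have um: "u < m" "u < c" "- u > \<sigma>" using \<epsilon>(1) by (auto simp: u_def m_def)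
  have nu: "\<not> is_pole F (of_real u)" using gap[of u] um by simp
  have nc: "\<not> is_pole F (of_real c)" using nopole by auto
  let ?P = "{\<rho>. 0 > \<rho> \<and> \<rho> \<ge> -\<sigma> \<and> is_pole F (of_real \<rho>)}"
  \<comment> \<open>Nothing lies between \<open>u\<close> and \<open>m\<close> by the gap, and
    nothing between 0 and \<open>c\<close> by \<open>nopole\<close>; so the poles crossed are
    exactly those in [-\<sigma>, 0), whichever side of 0 the line \<open>c\<close> is on.\<close>
  have sets: "{\<rho>. u < \<rho> \<and> \<rho> < c \<and> is_pole F (of_real \<rho>)} = ?P"
  proof (intro equalityI subsetI)
    fix \<rho> assume "\<rho> \<in> {\<rho>. u < \<rho> \<and> \<rho> < c \<and> is_pole F (of_real \<rho>)}"
    then have \<rho>: "u < \<rho>" "\<rho> < c" "is_pole F (of_real \<rho>)" by auto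
    have "\<rho> \<ge> m" using gap[of \<rho>] \<rho> by force
    moreover have "\<rho> < 0" using nopole \<rho> by force
    ultimately show "\<rho> \<in> ?P" using \<rho> unfolding m_def by (auto simp: min_def split: if_splits)
  next
    fix \<rho> assume "\<rho> \<in> ?P"
    then have \<rho>: "0 > \<rho>" "\<rho> \<ge> -\<sigma>" "is_pole F (of_real \<rho>)" by auto
    then have "\<rho> < c" using nopole by force
    then show "\<rho> \<in> {\<rho>. u < \<rho> \<and> \<rho> < c \<and> is_pole F (of_real \<rho>)}" using \<rho> um by (auto simp: m_def)
  qed
  define U where "U = (\<lambda>y. CLINT t|lborel. F (Complex u t) * exp (- (Complex u t * of_real y)))"
  have diff: "complex_of_real (g y) -
     (\<Sum>\<rho>\<in>?P. \<Sum>l<pole_order F (of_real \<rho>).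
        singular_coeff F (of_real \<rho>) (l + 1) / fact l * of_real (exp (\<bar>\<rho>\<bar> * y) * (- y) ^ l)) = 1 / (2 * pi) * U y" for y
  proof -
    have "(\<Sum>\<rho>\<in>?P. residue (\<lambda>s. F s * exp (- of_real y * s)) (of_real \<rho>)) =
      (\<Sum>\<rho>\<in>?P. \<Sum>l<pole_order F (of_real \<rho>).
        singular_coeff F (of_real \<rho>) (l + 1) / fact l * of_real (exp (\<bar>\<rho>\<bar> * y) * (- y) ^ l))"
    proof (rule sum.cong[OF refl])
      fix \<rho> assume \<rho>: "\<rho> \<in> ?P"
      then have pole: "is_pole F (of_real \<rho>)" by simp
      have e: "exp (- complex_of_real y * of_real \<rho>) = of_real (exp (\<bar>\<rho>\<bar> * y))"
        using \<rho> by (simp add: mult.commute flip: exp_of_real)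
      show "residue (\<lambda>s. F s * exp (- of_real y * s)) (of_real \<rho>) =
         (\<Sum>l<pole_order F (of_real \<rho>). singular_coeff F (of_real \<rho>) (l + 1) / fact l * of_real (exp (\<bar>\<rho>\<bar> * y) * (- y) ^ l))"
        unfolding residue_times_exp[OF has_laurent_expansion_at pole] e
        by (simp add: sum_distrib_left mult_ac)
    qed
    then show ?thesis
      unfolding g contour_shift[OF um(2) nu nc] sets U_def by (simp add: field_simps)
  qed
  define B where "B = (LINT t|lborel. norm (F (Complex u t)))"
  have Ubd: "norm (U y) \<le> exp (- u * y) * B" for y
  proof -
    have "norm (U y) \<le> (LINT t|lborel. norm (F (Complex u t) * exp (- (Complex u t * of_real y))))"
      unfolding U_def by (rule integral_norm_bound)
    also have "\<dots> = exp (- u * y) * B" unfolding B_def by (simp add: norm_mult mult.commute)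
    finally show ?thesis .
  qed
  have "(\<lambda>y. 1 / (2 * pi) * U y) \<in> O[at_bot](\<lambda>y. of_real (exp (- u * y)))"
  proof (rule bigoI[where c = "1 / (2 * pi) * B"], rule always_eventually, rule allI)
    fix y
    show "norm (1 / (2 * pi) * U y) \<le> 1 / (2 * pi) * B * norm (complex_of_real (exp (- u * y)))"
      using Ubd[of y] by (simp add: norm_mult norm_divide field_simps)
  qed
  then show ?thesis unfolding diff using um(3) by (intro exI[of _ "- u"]) auto
qed

end

section \<open>Functions of Gamma type: the density formula and the final theorem\<close>

lemma vertically_decaying_gamma_type_fun:
  assumes "D > 0" "\<forall>j\<in>{1..J}. a j \<noteq> 0" "\<forall>k\<in>{1..K}. a' k \<noteq> 0"
    and "gamma_exponent J K a a' > 0"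
  shows "vertically_decaying (gamma_type_fun J K C D a b a' b') (pi / 2 * gamma_exponent J K a a')"
proof
  show "gamma_type_fun J K C D a b a' b' nicely_meromorphic_on UNIV"
    by (rule gamma_type_fun_nicely_meromorphic[OF assms(1-3)])
  show "Im s = 0" if "is_pole (gamma_type_fun J K C D a b a' b') s" for s
    by (rule gamma_singularities_real[OF assms(1-3) gamma_type_fun_poles[OF assms(1-3) that]])
  show "finite {s. is_pole (gamma_type_fun J K C D a b a' b') s \<and> x1 \<le> Re s \<and> Re s \<le> x2}" for x1 x2
    by (rule finite_gamma_type_fun_poles[OF assms(1-3)])
  show "vertical_growth x1 x2 (gamma_type_fun J K C D a b a' b') (- (pi / 2 * gamma_exponent J K a a'))" for x1 x2
    using gamma_type_fun_vertical_growth[OF assms(1-3), of x1 x2] by simp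
qed (use assms in simp)

text \<open>The given interval is enlarged so that its closure contains 0, the moment function being
  finite there. The bounded moment function continues \<open>F\<close> over the enlarged strip,
  which excludes poles on the closed segment from 0 to \<open>c\<close> and identifies the tilted
  characteristic function with \<open>F\<close> on the line.\<close>

lemma (in prob_space) gamma_type_density:
  fixes X :: "'a \<Rightarrow> real"
  assumes X[measurable]: "X \<in> borel_measurable M" and pos: "AE \<omega> in M. X \<omega> > 0"
    and mom: "moments_of_gamma_type M X J K C D a b a' b'"
    and \<gamma>: "gamma_exponent J K a a' > 0"
  defines "F \<equiv> gamma_type_fun J K C D a b a' b'"
  obtains g c where "density_continuous_on M (\<lambda>\<omega>. ln (X \<omega>)) UNIV g"
    "\<forall>x\<in>{min 0 c..max 0 c}. \<not> is_pole F (of_real x)"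
    "\<And>y. complex_of_real (g y) = 1 / (2 * pi) * (CLINT t|lborel. F (Complex c t) * exp (- (Complex c t * of_real y)))"
proof -
  from mom have D: "D > 0" and a: "\<forall>j\<in>{1..J}. a j \<noteq> 0" and a': "\<forall>k\<in>{1..K}. a' k \<noteq> 0"
    unfolding moments_of_gamma_type_def by auto
  from mom obtain I \<alpha> \<beta> where I: "is_interval I" "\<alpha> \<in> I" "\<beta> \<in> I" "\<alpha> < \<beta>"
    and EX: "\<And>s. s \<in> I \<Longrightarrow> integrable M (\<lambda>\<omega>. X \<omega> powr s)"
      "\<And>s. s \<in> I \<Longrightarrow> complex_of_real (\<integral>\<omega>. X \<omega> powr s \<partial>M) = F (of_real s)"
    unfolding moments_of_gamma_type_def F_def by metis
  interpret F: vertically_decaying F "pi / 2 * gamma_exponent J K a a'"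
    unfolding F_def by (rule vertically_decaying_gamma_type_fun[OF D a a' \<gamma>])
  define Y where "Y = (\<lambda>\<omega>. ln (X \<omega>))"
  have [measurable]: "Y \<in> borel_measurable M" unfolding Y_def by measurable
  have powr: "AE \<omega> in M. X \<omega> powr s = exp (s * Y \<omega>)" for s
    using pos by eventually_elim (simp add: Y_def powr_def)
  have intI: "integrable M (\<lambda>\<omega>. exp (s * Y \<omega>))" if "s \<in> I" for s
    using EX(1)[OF that] powr by (subst integrable_cong_AE[symmetric, OF _ _ powr]) auto
  define \<Phi> where "\<Phi> = (\<lambda>s::complex. CLINT \<omega>|M. exp (s * Y \<omega>))"
  have \<Phi>F: "\<Phi> (of_real x) = F (of_real x)" if "x \<in> I" for x
  proof -
    have "\<Phi> (of_real x) = (CLINT \<omega>|M. of_real (exp (x * Y \<omega>)))"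
      unfolding \<Phi>_def by (simp flip: exp_of_real)
    also have "\<dots> = of_real (\<integral>\<omega>. exp (x * Y \<omega>) \<partial>M)" by (rule integral_complex_of_real)
    also have "(\<integral>\<omega>. exp (x * Y \<omega>) \<partial>M) = (\<integral>\<omega>. X \<omega> powr x \<partial>M)"
      using powr[of x] by (intro integral_cong_AE) (auto elim: eventually_mono)
    finally show ?thesis using EX(2)[OF that] by simp
  qed
  \<comment> \<open>The moment of order 0 is 1, so finiteness at 0, \<open>\<alpha>\<close> and
    \<open>\<beta>\<close> extends to everything between the extremes.\<close>
  define p q where "p = min 0 \<alpha>" and "q = max 0 \<beta>"
  have pq: "p \<le> \<alpha>" "\<beta> \<le> q" "p < q" "p \<le> 0" "0 \<le> q" using I by (auto simp: p_def q_def)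
  have "integrable M (\<lambda>\<omega>. exp (0 * Y \<omega>))" by simp
  then have int: "integrable M (\<lambda>\<omega>. exp (p * Y \<omega>))" "integrable M (\<lambda>\<omega>. exp (q * Y \<omega>))"
    unfolding p_def q_def using intI[OF I(2)] intI[OF I(3)] by (auto simp: min_def max_def)
  have hol: "\<Phi> holomorphic_on {s. p < Re s \<and> Re s < q}"
    unfolding \<Phi>_def by (rule exp_moment_holomorphic[OF _ int]) simp
  have F\<Phi>: "F s = \<Phi> s" if "p < Re s" "Re s < q" for s
    unfolding F_def
  proof (rule gamma_type_fun_continuation[OF D a a' hol pq(1) I(4) pq(2) _ that])
    fix x assume "\<alpha> < x" "x < \<beta>"
    then have "x \<in> I" using I mem_is_interval_1_I[of I \<alpha> \<beta> x] by auto
    then show "\<Phi> (of_real x) = gamma_type_fun J K C D a b a' b' (of_real x)" using \<Phi>F F_def by simp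
  qed
  define B where "B = expectation (\<lambda>\<omega>. exp (p * Y \<omega>)) + expectation (\<lambda>\<omega>. exp (q * Y \<omega>))"
  have bd: "norm (F s) \<le> B" if "p < Re s" "Re s < q" for s
    unfolding F\<Phi>[OF that] \<Phi>_def B_def using that by (intro exp_moment_norm_le[OF _ int]) auto
  have nopole: "\<not> is_pole F (of_real x)" if "p \<le> x" "x \<le> q" for x
    unfolding F_def
    by (rule gamma_type_fun_no_pole_closed_interval[OF D a a' pq(3) that bd[unfolded F_def]]) auto
  define c where "c = (\<alpha> + \<beta>) / 2"
  have c: "p < c" "c < q" using pq I by (auto simp: c_def)
  have nopole_c: "\<forall>x\<in>{min 0 c..max 0 c}. \<not> is_pole F (of_real x)"
    using c pq by (intro ballI nopole) (auto simp: min_def max_def split: if_splits)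
  have line: "(CLINT \<omega>|M. exp (Complex c t * Y \<omega>)) = F (Complex c t)" for t
    using F\<Phi>[of "Complex c t"] c by (simp add: \<Phi>_def)
  have "integrable lborel (\<lambda>t. CLINT \<omega>|M. exp (Complex c t * Y \<omega>))"
    unfolding line using nopole_c by (intro F.vertical_line_integrable) auto
  moreover have "integrable M (\<lambda>\<omega>. exp (c * Y \<omega>))"
    using c by (intro exp_moment_integrable_real[OF _ int]) auto
  ultimately obtain g where "density_continuous_on M Y UNIV g"
    "\<And>y. complex_of_real (g y) = 1 / (2 * pi) * (CLINT t|lborel. F (Complex c t) * exp (- (Complex c t * of_real y)))"
    using density_from_exponential_moments[of Y c] unfolding line by auto
  then show ?thesis using that nopole_c unfolding Y_def by blast
qed

theorem theorem6p8:
  fixes M :: "'a measure" and X Y :: "'a \<Rightarrow> real"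
    and J K \<nu> :: nat and C D r :: real and a b a' b' :: "nat \<Rightarrow> real"
    and F :: "complex \<Rightarrow> complex"
  assumes "prob_space M"
    and "X \<in> borel_measurable M"
    and "AE \<omega> in M. X \<omega> > 0"
    and "moments_of_gamma_type M X J K C D a b a' b'"
    and "F = gamma_type_fun J K C D a b a' b'"
    and "Y = (\<lambda>\<omega>. ln (X \<omega>))"
    and "rho_minus F > -\<infinity>"
    and "gamma_exponent J K a a' > 0"
    and "r = real_of_ereal (rho_minus F)"
    and "\<nu> = pole_order F (of_real r)"
  shows
    "(\<exists>f. density_continuous_on M X {0<..} f) \<and>
     (\<exists>g. density_continuous_on M Y UNIV g) \<and>
     (\<forall>fX fY. density_continuous_on M X {0<..} fX \<and> density_continuous_on M Y UNIV fY \<longrightarrow>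
        \<comment> \<open>asymptotics of the density of X\<close>
        (\<exists>\<eta>>0. (\<lambda>x. complex_of_real (fX x) -
             of_real (x powr (\<bar>r\<bar> - 1)) *
               (\<Sum>l<\<nu>. singular_coeff F (of_real r) (l + 1) / fact l * of_real (ln (1 / x) ^ l)))
           \<in> O[at_right 0](\<lambda>x. of_real (x powr (\<bar>r\<bar> - 1 + \<eta>)))) \<and>
        \<nu> \<ge> 1 \<and>
        (\<lambda>x. complex_of_real (fX x)) \<sim>[at_right 0]
          (\<lambda>x. singular_coeff F (of_real r) \<nu> / fact (\<nu> - 1) *
             of_real (x powr (\<bar>r\<bar> - 1) * ln (1 / x) ^ (\<nu> - 1))) \<and>
        (\<nu> = 1 \<longrightarrow>
          (\<lambda>x. complex_of_real (fX x)) \<sim>[at_right 0]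
            (\<lambda>x. residue F (of_real r) * of_real (x powr (\<bar>r\<bar> - 1)))) \<and>
        (\<forall>\<sigma>>0. (\<lambda>x. complex_of_real (fX x) -
             (\<Sum>\<rho> | 0 > \<rho> \<and> \<rho> \<ge> -\<sigma> \<and> is_pole F (of_real \<rho>).
                \<Sum>l<pole_order F (of_real \<rho>).
                  singular_coeff F (of_real \<rho>) (l + 1) / fact l *
                    of_real (x powr (\<bar>\<rho>\<bar> - 1) * ln (1 / x) ^ l)))
           \<in> O[at_right 0](\<lambda>x. of_real (x powr (\<sigma> - 1)))) \<and>
        \<comment> \<open>asymptotics of the density of Y\<close>
        (\<forall>y. fY y = exp y * fX (exp y)) \<and>
        (\<exists>\<eta>>0. (\<lambda>y. complex_of_real (fY y) -
             of_real (exp (\<bar>r\<bar> * y)) *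
               (\<Sum>l<\<nu>. singular_coeff F (of_real r) (l + 1) / fact l * of_real ((- y) ^ l)))
           \<in> O[at_bot](\<lambda>y. of_real (exp ((\<bar>r\<bar> + \<eta>) * y)))) \<and>
        (\<lambda>y. complex_of_real (fY y)) \<sim>[at_bot]
          (\<lambda>y. singular_coeff F (of_real r) \<nu> / fact (\<nu> - 1) *
             of_real (exp (\<bar>r\<bar> * y) * (- y) ^ (\<nu> - 1))) \<and>
        (\<nu> = 1 \<longrightarrow>
          (\<lambda>y. complex_of_real (fY y)) \<sim>[at_bot]
            (\<lambda>y. residue F (of_real r) * of_real (exp (\<bar>r\<bar> * y)))) \<and>
        (\<forall>\<sigma>>0. (\<lambda>y. complex_of_real (fY y) -
             (\<Sum>\<rho> | 0 > \<rho> \<and> \<rho> \<ge> -\<sigma> \<and> is_pole F (of_real \<rho>).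
                \<Sum>l<pole_order F (of_real \<rho>).
                  singular_coeff F (of_real \<rho>) (l + 1) / fact l *
                    of_real (exp (\<bar>\<rho>\<bar> * y) * (- y) ^ l)))
           \<in> O[at_bot](\<lambda>y. of_real (exp (\<sigma> * y)))))"
proof -
  interpret prob_space M by fact
  have D: "D > 0" and a: "\<forall>j\<in>{1..J}. a j \<noteq> 0" and a': "\<forall>k\<in>{1..K}. a' k \<noteq> 0"
    using assms(4) unfolding moments_of_gamma_type_def by auto
  interpret vertically_decaying F "pi / 2 * gamma_exponent J K a a'"
    unfolding assms(5) by (rule vertically_decaying_gamma_type_fun[OF D a a' assms(8)])
  note r = rho_minus_greatest_pole[OF assms(7), folded assms(9)]
  obtain g c where g: "density_continuous_on M Y UNIV g"
    and nopole: "\<forall>x\<in>{min 0 c..max 0 c}. \<not> is_pole F (of_real x)"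
    and g_eq: "\<And>y. complex_of_real (g y) = 1 / (2 * pi) * (CLINT t|lborel. F (Complex c t) * exp (- (Complex c t * of_real y)))"
    using gamma_type_density[OF assms(2,3,4,8)] unfolding assms(5,6) by blast
  note expansion = inverse_mellin_expansion[OF nopole g_eq]
  have f: "density_continuous_on M X {0<..} (\<lambda>x. if x > 0 then g (ln x) / x else 0)"
    using density_exp_transform[OF assms(2,3)] g unfolding assms(6) by blast
  have \<nu>: "\<nu> \<ge> 1" and lead: "singular_coeff F (of_real r) \<nu> \<noteq> 0"
    using pole_order_pos[OF r(2)] assms(10) by auto
  define coeff where "coeff = (\<lambda>l. singular_coeff F (of_real r) (l + 1) / fact l)"
  have lead': "coeff (\<nu> - 1) = singular_coeff F (of_real r) \<nu> / fact (\<nu> - 1)" "coeff (\<nu> - 1) \<noteq> 0"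
    using \<nu> lead by (auto simp: coeff_def)
  \<comment> \<open>With \<open>\<sigma> = \<bar>r\<bar>\<close> the sum over poles reduces to the
    greatest negative one, so part (i) becomes a case of the general expansion, with
    \<open>\<eta>\<close> the gain \<open>\<sigma>' - \<bar>r\<bar>\<close>.\<close>
  have only: "{\<rho>. 0 > \<rho> \<and> \<rho> \<ge> - \<bar>r\<bar> \<and> is_pole F (of_real \<rho>)} = {r}"
    using r by force
  obtain \<sigma>' where \<sigma>': "\<sigma>' > \<bar>r\<bar>" and Ysum: "(\<lambda>y. complex_of_real (g y) -
      (\<Sum>l<\<nu>. coeff l * of_real (exp (\<bar>r\<bar> * y) * (- y) ^ l))) \<in> O[at_bot](\<lambda>y. of_real (exp (\<sigma>' * y)))"
    using expansion[of "\<bar>r\<bar>"] r(1) unfolding only coeff_def assms(10) by auto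
  define \<eta> where "\<eta> = \<sigma>' - \<bar>r\<bar>"
  have \<eta>: "\<eta> > 0" using \<sigma>' by (simp add: \<eta>_def)
  have Y1: "(\<lambda>y. complex_of_real (g y) - of_real (exp (\<bar>r\<bar> * y)) * (\<Sum>l<\<nu>. coeff l * of_real ((- y) ^ l)))
      \<in> O[at_bot](\<lambda>y. of_real (exp ((\<bar>r\<bar> + \<eta>) * y)))"
    using Ysum by (simp add: \<eta>_def sum_distrib_left mult.left_commute)
  have Y2: "(\<lambda>y. complex_of_real (g y)) \<sim>[at_bot]
      (\<lambda>y. coeff (\<nu> - 1) * of_real (exp (\<bar>r\<bar> * y) * (- y) ^ (\<nu> - 1)))"
    by (rule exp_times_polynomial_asymp[OF Y1 \<eta> \<nu> lead'(2)])
  have Y3: "(\<lambda>y. complex_of_real (g y)) \<sim>[at_bot] (\<lambda>y. residue F (of_real r) * of_real (exp (\<bar>r\<bar> * y)))"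
    if "\<nu> = 1" using Y2 that by (simp add: coeff_def residue_eq_singular_coeff)
  have Y4: "(\<lambda>y. complex_of_real (g y) -
      (\<Sum>\<rho> | 0 > \<rho> \<and> \<rho> \<ge> -\<sigma> \<and> is_pole F (of_real \<rho>). \<Sum>l<pole_order F (of_real \<rho>).
         singular_coeff F (of_real \<rho>) (l + 1) / fact l * of_real (exp (\<bar>\<rho>\<bar> * y) * (- y) ^ l)))
      \<in> O[at_bot](\<lambda>y. of_real (exp (\<sigma> * y)))" (is "?e \<in> _") if \<sigma>: "\<sigma> > 0" for \<sigma>
  proof -
    obtain s where s: "s > \<sigma>" "?e \<in> O[at_bot](\<lambda>y. of_real (exp (s * y)))"
      using expansion[OF \<sigma>] by blast
    \<comment> \<open>For \<open>y \<le> 0\<close> the larger exponent \<open>s\<close> gives the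
      smaller exponential, so the gain is simply dropped.\<close>
    have "(\<lambda>y. complex_of_real (exp (s * y))) \<in> O[at_bot](\<lambda>y. of_real (exp (\<sigma> * y)))"
    proof (rule bigoI[where c = 1])
      show "\<forall>\<^sub>F y in at_bot. norm (complex_of_real (exp (s * y))) \<le> 1 * norm (complex_of_real (exp (\<sigma> * y)))"
        using eventually_le_at_bot[of 0]
        by eventually_elim (use s in \<open>auto intro: mult_right_mono_neg\<close>)
    qed
    with s(2) show ?thesis by (rule landau_o.big_trans)
  qed
  have pw: "complex_of_real (x powr (s - 1)) = of_real (exp (s * ln x)) / of_real x" if "x > 0" for x s :: real
    using that by (simp add: powr_def left_diff_distrib exp_diff)
  have lnx: "ln (1 / x) = - ln x" if "x > 0" for x :: real
    using that by (simp add: ln_div)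
  show ?thesis
  proof (intro conjI allI impI)
    show "\<exists>f. density_continuous_on M X {0<..} f" "\<exists>g. density_continuous_on M Y UNIV g"
      using f g by blast+
  next
    fix fX fY
    assume dens: "density_continuous_on M X {0<..} fX \<and> density_continuous_on M Y UNIV fY"
    \<comment> \<open>By uniqueness of continuous densities, arbitrary \<open>fY\<close> and
      \<open>fX\<close> are the constructed ones, the latter only on the positive half-line; this
      suffices for limits at 0 from the right.\<close>
    have fY: "fY = g" using density_continuous_on_unique[of M Y UNIV fY g] dens g by auto
    have fX: "fX x = g (ln x) / x" if "x > 0" for x
      using density_continuous_on_unique[OF _ f, of fX x] dens that by auto
    have X1: "(\<lambda>x. complex_of_real (fX x) - of_real (x powr (\<bar>r\<bar> - 1)) * (\<Sum>l<\<nu>. coeff l * of_real (ln (1 / x) ^ l)))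
        \<in> O[at_right 0](\<lambda>x. of_real (x powr (\<bar>r\<bar> + \<eta> - 1)))"
      by (rule bigo_exp_to_powr[OF Y1]) (simp add: fX pw lnx diff_divide_distrib)
    have exponent: "\<bar>r\<bar> + \<eta> - 1 = \<bar>r\<bar> - 1 + \<eta>" by simp
    show "\<exists>\<eta>>0. (\<lambda>x. complex_of_real (fX x) -
             of_real (x powr (\<bar>r\<bar> - 1)) *
               (\<Sum>l<\<nu>. singular_coeff F (of_real r) (l + 1) / fact l * of_real (ln (1 / x) ^ l)))
           \<in> O[at_right 0](\<lambda>x. of_real (x powr (\<bar>r\<bar> - 1 + \<eta>)))"
      by (rule exI[of _ \<eta>], rule conjI[OF \<eta> X1[unfolded coeff_def exponent]])
    show "\<nu> \<ge> 1" by fact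
    show "(\<lambda>x. complex_of_real (fX x)) \<sim>[at_right 0]
          (\<lambda>x. singular_coeff F (of_real r) \<nu> / fact (\<nu> - 1) *
             of_real (x powr (\<bar>r\<bar> - 1) * ln (1 / x) ^ (\<nu> - 1)))"
      unfolding lead'(1)[symmetric]
      by (rule asymp_equiv_ln_transform[OF Y2]) (simp_all add: fX pw lnx)
    show "(\<lambda>x. complex_of_real (fX x)) \<sim>[at_right 0]
            (\<lambda>x. residue F (of_real r) * of_real (x powr (\<bar>r\<bar> - 1)))" if "\<nu> = 1"
      by (rule asymp_equiv_ln_transform[OF Y3[OF that]]) (simp_all add: fX pw)
    show "(\<lambda>x. complex_of_real (fX x) -
             (\<Sum>\<rho> | 0 > \<rho> \<and> \<rho> \<ge> -\<sigma> \<and> is_pole F (of_real \<rho>).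
                \<Sum>l<pole_order F (of_real \<rho>).
                  singular_coeff F (of_real \<rho>) (l + 1) / fact l *
                    of_real (x powr (\<bar>\<rho>\<bar> - 1) * ln (1 / x) ^ l)))
           \<in> O[at_right 0](\<lambda>x. of_real (x powr (\<sigma> - 1)))" if "\<sigma> > 0" for \<sigma>
      by (rule bigo_exp_to_powr[OF Y4[OF that]])
         (simp only: fX pw lnx diff_divide_distrib sum_divide_distrib of_real_mult of_real_divide
             times_divide_eq_left times_divide_eq_right)
    show "fY y = exp y * fX (exp y)" for y by (simp add: fY fX)
    show "\<exists>\<eta>>0. (\<lambda>y. complex_of_real (fY y) -
             of_real (exp (\<bar>r\<bar> * y)) *
               (\<Sum>l<\<nu>. singular_coeff F (of_real r) (l + 1) / fact l * of_real ((- y) ^ l)))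
           \<in> O[at_bot](\<lambda>y. of_real (exp ((\<bar>r\<bar> + \<eta>) * y)))"
      unfolding fY by (rule exI[of _ \<eta>], rule conjI[OF \<eta> Y1[unfolded coeff_def]])
    show "(\<lambda>y. complex_of_real (fY y)) \<sim>[at_bot]
          (\<lambda>y. singular_coeff F (of_real r) \<nu> / fact (\<nu> - 1) *
             of_real (exp (\<bar>r\<bar> * y) * (- y) ^ (\<nu> - 1)))"
      using Y2 unfolding fY lead'(1) .
    show "(\<lambda>y. complex_of_real (fY y)) \<sim>[at_bot]
            (\<lambda>y. residue F (of_real r) * of_real (exp (\<bar>r\<bar> * y)))" if "\<nu> = 1"
      using Y3[OF that] unfolding fY .
    show "(\<lambda>y. complex_of_real (fY y) -
             (\<Sum>\<rho> | 0 > \<rho> \<and> \<rho> \<ge> -\<sigma> \<and> is_pole F (of_real \<rho>).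
                \<Sum>l<pole_order F (of_real \<rho>).
                  singular_coeff F (of_real \<rho>) (l + 1) / fact l *
                    of_real (exp (\<bar>\<rho>\<bar> * y) * (- y) ^ l)))
           \<in> O[at_bot](\<lambda>y. of_real (exp (\<sigma> * y)))" if "\<sigma> > 0" for \<sigma>
      using Y4[OF that] unfolding fY .
  qed
qed

end
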